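(* Assume A1, A2 and A3(2) (see context). Then for any $\gamma\in(0,1/(2L)]$ the Markov kernel $Q_\gamma$ admits a unique invariant distribution $\pi_\gamma$. Moreover, $Q_\gamma$ is geometrically ergodic with respect to the cost function $c$, that is, for any initial distribution $\nu$ on $\mathbb{R}^d$ and any $k\in\mathbb{N}$, $$\mathbf{W}_c(\nu Q_\gamma^k,\pi_\gamma)\le 4\,(1/2)^{k/m(\gamma)}\,\mathbf{W}_c(\nu,\pi_\gamma),\qquad m(\gamma)=\Big\lceil \frac{2\log 4}{\gamma\mu}\Big\rceil .$$
   Context: Norms: $\|\cdot\|$ is the Euclidean norm on $\mathbb{R}^d$; for a tensor, $\|M\|=\sup\frac{\sum_{i_1,\dots,i_k}M_{i_1\dots i_k}x^1_{i_1}\cdots x^k_{i_k}}{\|x^1\|\cdots\|x^k\|}$ over nonzero vectors; $\nabla^k f(\theta)$ is the tensor of $k$-th partial derivatives. Problem: minimize $f:\mathbb{R}^d\to\mathbb{R}$, with unique minimizer $\theta^\star$; $\xi$ has distribution $P_\xi$ on a measurable space, and $\nabla F(\theta,\xi)\in\mathbb{R}^d$ (jointly measurable) is a stochastic gradient. A1: $f$ is continuously differentiable and $\mu$-strongly convex for some $\mu>0$: $\frac{\mu}{2}\|\theta-\theta'\|^2\le f(\theta)-f(\theta')-\langle\nabla f(\theta'),\theta-\theta'\rangle$ for all $\theta,\theta'$. A2: $f$ is $4$ times continuously differentiable, $\|\nabla f(\theta)-\nabla f(\theta')\|\le L_2\|\theta-\theta'\|$ for all $\theta,\theta'$, and $\|\nabla^i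 f(\theta)\|\le L_i$ for all $\theta$ and $i\in\{3,4\}$. A3(2): $(\xi_k)_{k\ge1}$ are i.i.d. with law $P_\xi$, independent of $\theta_0$; $E[\nabla F(\theta,\xi)]=\nabla f(\theta)$ for all $\theta$; $E^{1/2}[\|\nabla F(\theta^\star,\xi)\|^2]\le\tau_2$; and for some $L_1>0$ and all $\theta_1,\theta_2$: $L_1\langle\nabla f(\theta_1)-\nabla f(\theta_2),\theta_1-\theta_2\rangle\ge E[\|\nabla F(\theta_1,\xi)-\nabla F(\theta_2,\xi)\|^2]$. $L=\max(L_1,L_2,L_3,L_4)$. SGD with constant step: $\theta_{k+1}^{(\gamma)}=\theta_k^{(\gamma)}-\gamma\nabla F(\theta_k^{(\gamma)},\xi_{k+1})$, $\theta_0^{(\gamma)}=\theta_0\sim\nu$. Its Markov kernel is $Q_\gamma(\theta,A)=\int \mathbf{1}_A(\theta-\gamma\nabla F(\theta,z))\,P_\xi(dz)$, $A$ Borel. Cost function: $c(\theta,\theta')=\|\theta-\theta'\|\Big(\|\theta-\theta^\star\|+\|\theta'-\theta^\star\|+\frac{2\sqrt2\,\tau_2\sqrt\gamma}{\sqrt\mu}\Big)$. For probability measures $\zeta,\zeta'$ on $\mathbb{R}^d$, $\mathbf{W}_c(\zeta,\zeta')=\inf_{\Pi}\int c(z,z')\,\Pi(dz,dz')$, the infimum over all couplings $\Pi$ of $(\zeta,\zeta')$ (it may be $+\infty$). *)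

theory Defs
  imports "HOL-Probability.Probability"
begin

definition partial_deriv :: "'d::finite \<Rightarrow> (real^'d \<Rightarrow> real) \<Rightarrow> real^'d \<Rightarrow> real" where
  "partial_deriv i f x = deriv (\<lambda>t. f (x + t *\<^sub>R axis i 1)) 0"

definition grad :: "(real^'d::finite \<Rightarrow> real) \<Rightarrow> real^'d \<Rightarrow> real^'d" where
  "grad f x = (\<chi> i. partial_deriv i f x)"

(* k times continuously differentiable on the whole space.  Differentiability is required
   explicitly at each stage because deriv is a total operator. *)
primrec Ck :: "nat \<Rightarrow> (real^'d::finite \<Rightarrow> real) \<Rightarrow> bool" where
  "Ck 0 f \<longleftrightarrow> continuous_on UNIV f"
| "Ck (Suc k) f \<longleftrightarrow> (\<forall>x. f differentiable (at x)) \<and> (\<forall>i. Ck k (partial_deriv i f))"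

(* A tensor of order k is a function on index lists; only its values on lists of length k matter.
   The tensor of k-th derivatives of f at x is (\<lambda>js. partial_derivs js f x). *)
primrec partial_derivs :: "'d::finite list \<Rightarrow> (real^'d \<Rightarrow> real) \<Rightarrow> real^'d \<Rightarrow> real" where
  "partial_derivs [] f = f"
| "partial_derivs (i # js) f = partial_deriv i (partial_derivs js f)"

(* The set is nonempty and bounded above, so Sup on the reals is a genuine supremum. *)
definition tensor_norm :: "nat \<Rightarrow> ('d::finite list \<Rightarrow> real) \<Rightarrow> real" where
  "tensor_norm k T =
     Sup {(\<Sum>js | length js = k. T js * (\<Prod>l<k. x l $ (js ! l))) / (\<Prod>l<k. norm (x l)) |
          x :: nat \<Rightarrow> real^'d. \<forall>l<k. x l \<noteq> 0}"

definition strongly_convex :: "real \<Rightarrow> (real^'d::finite \<Rightarrow> real) \<Rightarrow> bool" where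
  "strongly_convex \<mu> f \<longleftrightarrow> (\<forall>\<theta> \<theta>'.
     \<mu> / 2 * (norm (\<theta> - \<theta>'))\<^sup>2 \<le> f \<theta> - f \<theta>' - grad f \<theta>' \<bullet> (\<theta> - \<theta>'))"

(* G \<theta> z stands for the stochastic gradient \<nabla>F(\<theta>, z); P is the law of the noise. *)
definition sgd_kernel ::
    "'z measure \<Rightarrow> (real^'d::finite \<Rightarrow> 'z \<Rightarrow> real^'d) \<Rightarrow> real \<Rightarrow> real^'d \<Rightarrow> (real^'d) measure" where
  "sgd_kernel P G \<gamma> \<theta> = distr P borel (\<lambda>z. \<theta> - \<gamma> *\<^sub>R G \<theta> z)"

(* Independence of two random variables with values in different types, which the library's
   prob_space.indep_var does not allow. *)
definition indep_rvs ::
    "'w measure \<Rightarrow> 'a measure \<Rightarrow> ('w \<Rightarrow> 'a) \<Rightarrow> 'b measure \<Rightarrow> ('w \<Rightarrow> 'b) \<Rightarrow> bool" where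
  "indep_rvs M S X T Y \<longleftrightarrow> X \<in> M \<rightarrow>\<^sub>M S \<and> Y \<in> M \<rightarrow>\<^sub>M T \<and>
     prob_space.indep_set M (sets (vimage_algebra (space M) X S)) (sets (vimage_algebra (space M) Y T))"

definition iterate_kernel :: "('a \<Rightarrow> 'a measure) \<Rightarrow> nat \<Rightarrow> 'a measure \<Rightarrow> 'a measure" where
  "iterate_kernel Q k \<nu> = ((\<lambda>\<rho>. bind \<rho> Q) ^^ k) \<nu>"

definition invariant_distribution ::
    "('a::topological_space \<Rightarrow> 'a measure) \<Rightarrow> 'a measure \<Rightarrow> bool" where
  "invariant_distribution Q \<pi> \<longleftrightarrow> \<pi> \<in> space (prob_algebra borel) \<and> bind \<pi> Q = \<pi>"

definition couplings ::
    "'a::topological_space measure \<Rightarrow> 'a measure \<Rightarrow> ('a \<times> 'a) measure set" where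
  "couplings \<zeta> \<zeta>' = {\<Gamma> \<in> space (prob_algebra (borel \<Otimes>\<^sub>M borel)).
     distr \<Gamma> borel fst = \<zeta> \<and> distr \<Gamma> borel snd = \<zeta>'}"

definition wasserstein ::
    "('a::topological_space \<Rightarrow> 'a \<Rightarrow> real) \<Rightarrow> 'a measure \<Rightarrow> 'a measure \<Rightarrow> ennreal" where
  "wasserstein c \<zeta> \<zeta>' = (INF \<Gamma> \<in> couplings \<zeta> \<zeta>'. \<integral>\<^sup>+ p. ennreal (c (fst p) (snd p)) \<partial>\<Gamma>)"

definition sgd_cost ::
    "real^'d::finite \<Rightarrow> real \<Rightarrow> real \<Rightarrow> real \<Rightarrow> real^'d \<Rightarrow> real^'d \<Rightarrow> real" where
  "sgd_cost \<theta>s \<tau> \<mu> \<gamma> \<theta> \<theta>' = norm (\<theta> - \<theta>') *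
     (norm (\<theta> - \<theta>s) + norm (\<theta>' - \<theta>s) + 2 * sqrt 2 * \<tau> * sqrt \<gamma> / sqrt \<mu>)"

end

theory Submission
  imports Defs
begin

text \<open>Write \<open>T x z = x - \<gamma> G x z\<close> and drive two copies of the chain by the same noise. Expanding the
square, co-coercivity and strong convexity give \<open>E |T x - T y|^2 \<le> r |x - y|^2\<close> and
\<open>E |T x - \<theta>s|^2 \<le> r |x - \<theta>s|^2 + (1 - r) B\<close> with \<open>r = 1 - \<gamma> \<mu>\<close> and \<open>B = 2 \<gamma> \<tau>2^2 / \<mu>\<close>; the
constant in the cost is \<open>2 sqrt B\<close>. By Cauchy--Schwarz the expected cost after \<open>k\<close> steps is at most
\<open>2 r^(k/2)\<close> times the initial cost, and integrating over a coupling of the initial laws gives the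
Wasserstein bound. The invariant law is the law of the almost sure limit of the backward
iterates. It is unique because \<open>E min 1 |x - y|\<close> tends to zero along the coupled chain from
every initial coupling, without any moment assumption.\<close>

subsection \<open>Iterated kernels\<close>

lemma iterate_kernel_0 [simp]: "iterate_kernel Q 0 \<nu> = \<nu>"
  by (simp add: iterate_kernel_def)

lemma iterate_kernel_Suc [simp]: "iterate_kernel Q (Suc k) \<nu> = iterate_kernel Q k \<nu> \<bind> Q"
  by (simp add: iterate_kernel_def)

lemma sets_prob_algebra: "\<nu> \<in> space (prob_algebra N) \<Longrightarrow> sets \<nu> = sets N"
  by (simp add: space_prob_algebra)

lemma iterate_kernel_prob_algebra:
  assumes "Q \<in> borel \<rightarrow>\<^sub>M prob_algebra borel" "\<nu> \<in> space (prob_algebra borel)"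
  shows "iterate_kernel Q k \<nu> \<in> space (prob_algebra borel)"
proof (induction k)
  case (Suc k)
  then show ?case
    using assms(1) prob_space_bind'[OF Suc assms(1)] sets_bind'[OF Suc assms(1)]
    by (simp add: space_prob_algebra)
qed (use assms in simp)

lemma measurable_iterate_kernel:
  assumes Q: "Q \<in> borel \<rightarrow>\<^sub>M prob_algebra borel"
  shows "(\<lambda>x. iterate_kernel Q k (return borel x)) \<in> borel \<rightarrow>\<^sub>M prob_algebra borel"
proof (induction k)
  case (Suc k)
  then show ?case
    using measurable_bind_prob_space[OF Suc Q] by simp
qed simp

text \<open>Chapman--Kolmogorov: associativity of \<open>bind\<close> moves the initial law out of
  the iteration, so that estimates for a deterministic start can be integrated over any initial
  law.\<close>

lemma iterate_kernel_eq_bind: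
  assumes Q: "Q \<in> borel \<rightarrow>\<^sub>M prob_algebra borel" and \<nu>: "\<nu> \<in> space (prob_algebra borel)"
  shows "iterate_kernel Q k \<nu> = \<nu> \<bind> (\<lambda>x. iterate_kernel Q k (return borel x))"
proof (induction k)
  case 0
  then show ?case
    using bind_return''[of \<nu> borel] \<nu> by (simp add: space_prob_algebra)
next
  case (Suc k)
  have "(\<lambda>x. iterate_kernel Q k (return borel x)) \<in> \<nu> \<rightarrow>\<^sub>M subprob_algebra borel"
    using measurable_prob_algebraD[OF measurable_iterate_kernel[OF Q]] sets_prob_algebra[OF \<nu>]
    by (simp cong: measurable_cong_sets)
  from bind_assoc[OF this measurable_prob_algebraD[OF Q]] Suc show ?case
    by simp
qed

section \<open>Integrals against iterated kernels and geometric drift\<close>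

lemma nn_integral_bind_kernel:
  assumes "Q \<in> borel \<rightarrow>\<^sub>M prob_algebra borel" "\<nu> \<in> space (prob_algebra borel)"
    and "\<phi> \<in> borel_measurable borel"
  shows "(\<integral>\<^sup>+y. \<phi> y \<partial>(\<nu> \<bind> Q)) = (\<integral>\<^sup>+x. \<integral>\<^sup>+y. \<phi> y \<partial>Q x \<partial>\<nu>)"
  using assms measurable_prob_algebraD[OF assms(1)] sets_prob_algebra[OF assms(2)]
  by (intro nn_integral_bind[where B = borel]) (simp_all cong: measurable_cong_sets)

lemma nn_integral_iterate_kernel:
  assumes Q: "Q \<in> borel \<rightarrow>\<^sub>M prob_algebra borel" and \<nu>: "\<nu> \<in> space (prob_algebra borel)"
    and \<phi>: "\<phi> \<in> borel_measurable borel"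
  shows "(\<integral>\<^sup>+y. \<phi> y \<partial>iterate_kernel Q k \<nu>) =
    (\<integral>\<^sup>+x. \<integral>\<^sup>+y. \<phi> y \<partial>iterate_kernel Q k (return borel x) \<partial>\<nu>)"
  unfolding iterate_kernel_eq_bind[OF Q \<nu>]
  by (rule nn_integral_bind_kernel[OF measurable_iterate_kernel[OF Q] \<nu> \<phi>])

text \<open>Asking only for \<open>r * B + d \<le> B\<close> avoids summing a geometric series and
  subtracting in \<open>ennreal\<close>. The case \<open>d = B = 0\<close> is plain geometric
  decay.\<close>

lemma nn_integral_iterate_kernel_drift:
  fixes V :: "'a::topological_space \<Rightarrow> ennreal"
  assumes Q: "Q \<in> borel \<rightarrow>\<^sub>M prob_algebra borel" and \<nu>: "\<nu> \<in> space (prob_algebra borel)"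
    and V [measurable]: "V \<in> borel_measurable borel"
    and drift: "\<And>x. (\<integral>\<^sup>+y. V y \<partial>Q x) \<le> r * V x + d"
    and B: "r * B + d \<le> B"
  shows "(\<integral>\<^sup>+y. V y \<partial>iterate_kernel Q k \<nu>) \<le> r ^ k * (\<integral>\<^sup>+x. V x \<partial>\<nu>) + B"
proof (induction k)
  case (Suc k)
  let ?\<nu> = "iterate_kernel Q k \<nu>"
  note \<nu>k = iterate_kernel_prob_algebra[OF Q \<nu>, of k]
  then interpret prob_space ?\<nu> by (simp add: space_prob_algebra)
  have [measurable]: "V \<in> borel_measurable ?\<nu>"
    using sets_prob_algebra[OF \<nu>k] V by (simp cong: measurable_cong_sets)
  have "(\<integral>\<^sup>+y. V y \<partial>iterate_kernel Q (Suc k) \<nu>) = (\<integral>\<^sup>+x. \<integral>\<^sup>+y. V y \<partial>Q x \<partial>?\<nu>)"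
    using nn_integral_bind_kernel[OF Q \<nu>k V] by simp
  also have "\<dots> \<le> (\<integral>\<^sup>+x. r * V x + d \<partial>?\<nu>)"
    by (intro nn_integral_mono drift)
  also have "\<dots> = r * (\<integral>\<^sup>+x. V x \<partial>?\<nu>) + d"
    by (simp add: nn_integral_add nn_integral_cmult emeasure_space_1)
  also have "\<dots> \<le> r * (r ^ k * (\<integral>\<^sup>+x. V x \<partial>\<nu>) + B) + d"
    by (intro add_mono mult_left_mono Suc) auto
  also have "\<dots> = r ^ Suc k * (\<integral>\<^sup>+x. V x \<partial>\<nu>) + (r * B + d)"
    by (simp add: distrib_left mult_ac add_ac)
  also have "\<dots> \<le> r ^ Suc k * (\<integral>\<^sup>+x. V x \<partial>\<nu>) + B"
    by (intro add_left_mono B)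
  finally show ?case .
qed simp

subsection \<open>Synchronous coupling of a random map\<close>

text \<open>Generic in \<open>T\<close>, so that the chain and the coupled chain on pairs are
  instances of one construction.\<close>

definition map_kernel :: "'z measure \<Rightarrow> ('a \<Rightarrow> 'z \<Rightarrow> 'a) \<Rightarrow> 'a::topological_space \<Rightarrow> 'a measure" where
  "map_kernel P T x = distr P borel (T x)"

text \<open>The coupled chain lives on the Borel sets of the product topology; second countability
  identifies them with the product sigma-algebra.\<close>

lemma borel_measurable_fst_snd [measurable]:
  "fst \<in> borel_measurable (borel :: ('a::second_countable_topology \<times> 'b::second_countable_topology) measure)"
  "snd \<in> borel_measurable (borel :: ('a \<times> 'b) measure)"
  unfolding borel_prod[symmetric] by measurable

text \<open>Both coordinates receive the same noise \<open>z\<close>: each is a copy of the chain,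
  and the distance between them inherits the contraction of the random map.\<close>

definition pair_map :: "('a \<Rightarrow> 'z \<Rightarrow> 'a) \<Rightarrow> 'a \<times> 'a \<Rightarrow> 'z \<Rightarrow> 'a \<times> 'a" where
  "pair_map T p z = (T (fst p) z, T (snd p) z)"

lemma fst_pair_map [simp]: "fst (pair_map T p z) = T (fst p) z"
  and snd_pair_map [simp]: "snd (pair_map T p z) = T (snd p) z"
  by (simp_all add: pair_map_def)

locale random_map = prob_space P for P :: "'z measure" +
  fixes T :: "'a::second_countable_topology \<Rightarrow> 'z \<Rightarrow> 'a"
  assumes T_measurable [measurable]: "case_prod T \<in> borel_measurable (borel \<Otimes>\<^sub>M P)"
begin

lemma measurable_T [measurable]: "T x \<in> borel_measurable P"
proof -
  have "(\<lambda>z. case_prod T (x, z)) \<in> borel_measurable P"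
    by measurable
  then show ?thesis by simp
qed

lemma map_kernel_measurable: "map_kernel P T \<in> borel \<rightarrow>\<^sub>M prob_algebra borel"
proof -
  have "P \<in> space (prob_algebra P)"
    by (simp add: space_prob_algebra prob_space_axioms)
  then have "(\<lambda>x. distr P borel (T x)) \<in> borel \<rightarrow>\<^sub>M prob_algebra borel"
    by (intro measurable_distr_prob_space2[where M = P]) (simp_all add: T_measurable)
  then show ?thesis
    unfolding map_kernel_def[abs_def] .
qed

lemma random_map_pair: "random_map P (pair_map T)"
proof unfold_locales
  have "(\<lambda>(p, z). (T (fst p) z, T (snd p) z)) \<in> ((borel \<Otimes>\<^sub>M borel) \<Otimes>\<^sub>M P) \<rightarrow>\<^sub>M (borel \<Otimes>\<^sub>M borel)"
    by measurable
  then show "case_prod (pair_map T) \<in> borel_measurable (borel \<Otimes>\<^sub>M P)"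
    by (simp add: borel_prod pair_map_def[abs_def])
qed

lemma nn_integral_map_kernel:
  "\<phi> \<in> borel_measurable borel \<Longrightarrow> (\<integral>\<^sup>+y. \<phi> y \<partial>map_kernel P T x) = (\<integral>\<^sup>+z. \<phi> (T x z) \<partial>P)"
  unfolding map_kernel_def by (subst nn_integral_distr) auto

text \<open>Any \<open>\<pi>\<close> that intertwines \<open>pair_map T\<close> with
  \<open>T\<close> carries one coupled step to one step of the chain. The instances
  \<open>fst\<close> and \<open>snd\<close> give the two marginals at once.\<close>

lemma distr_bind_pair_map:
  assumes \<Gamma>: "\<Gamma> \<in> space (prob_algebra borel)"
    and \<pi> [measurable]: "\<pi> \<in> borel_measurable borel"
    and eq: "\<And>p z. \<pi> (pair_map T p z) = T (\<pi> p) z"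
  shows "distr (\<Gamma> \<bind> map_kernel P (pair_map T)) borel \<pi> = distr \<Gamma> borel \<pi> \<bind> map_kernel P T"
proof -
  interpret pair: random_map P "pair_map T" by (rule random_map_pair)
  have sets: "sets \<Gamma> = sets borel" and ne: "space \<Gamma> \<noteq> {}"
    using \<Gamma> by (auto simp: space_prob_algebra dest: prob_space.not_empty)
  have K: "map_kernel P (pair_map T) \<in> \<Gamma> \<rightarrow>\<^sub>M subprob_algebra borel"
    using measurable_prob_algebraD[OF pair.map_kernel_measurable] sets
    by (simp cong: measurable_cong_sets)
  have \<pi>': "\<pi> \<in> \<Gamma> \<rightarrow>\<^sub>M borel"
    using sets \<pi> by (simp cong: measurable_cong_sets)
  have "distr (map_kernel P (pair_map T) p) borel \<pi> = map_kernel P T (\<pi> p)" for p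
    unfolding map_kernel_def by (subst distr_distr) (auto simp: comp_def eq)
  then show ?thesis
    by (simp add: distr_bind[OF K ne \<pi>]
        bind_distr[OF \<pi>' measurable_prob_algebraD[OF map_kernel_measurable] ne])
qed

lemma couplings_iterate:
  assumes "\<Gamma> \<in> couplings \<nu> \<nu>'"
  shows "iterate_kernel (map_kernel P (pair_map T)) k \<Gamma> \<in>
    couplings (iterate_kernel (map_kernel P T) k \<nu>) (iterate_kernel (map_kernel P T) k \<nu>')"
proof (induction k)
  case (Suc k)
  interpret pair: random_map P "pair_map T" by (rule random_map_pair)
  let ?\<Gamma> = "iterate_kernel (map_kernel P (pair_map T)) k \<Gamma>"
  have \<Gamma>k: "?\<Gamma> \<in> space (prob_algebra borel)"
    using Suc by (simp add: couplings_def borel_prod)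
  moreover have "iterate_kernel (map_kernel P (pair_map T)) (Suc k) \<Gamma> \<in> space (prob_algebra borel)"
    using prob_space_bind'[OF \<Gamma>k pair.map_kernel_measurable]
      sets_bind'[OF \<Gamma>k pair.map_kernel_measurable]
    by (simp add: space_prob_algebra)
  ultimately show ?case
    using Suc distr_bind_pair_map[of ?\<Gamma> fst] distr_bind_pair_map[of ?\<Gamma> snd]
    by (simp add: couplings_def borel_prod borel_measurable_fst_snd)
qed (use assms in simp)

end

subsection \<open>Uniqueness of the invariant distribution of a contractive random map\<close>

text \<open>Mass in \<open>F\<close> is matched either with points of the closed
  \<open>\<delta>\<close>-neighbourhood of \<open>F\<close> or with points at distance at least
  \<open>\<delta>\<close>. By Markov's inequality the latter mass is at most
  \<open>1 / \<delta>\<close> times the truncated cost, which vanishes as \<open>k\<close> grows.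
  Then \<open>\<delta>\<close> tends to zero.\<close>

lemma emeasure_closed_le_if_couplings:
  fixes \<zeta> \<zeta>' :: "'a::{second_countable_topology, metric_space} measure"
  assumes C: "\<And>k::nat. \<Gamma> k \<in> couplings \<zeta> \<zeta>'"
    and lim: "(\<lambda>k. \<integral>\<^sup>+p. ennreal (min 1 (dist (fst p) (snd p))) \<partial>\<Gamma> k) \<longlonglongrightarrow> 0"
    and F: "closed F"
  shows "emeasure \<zeta> F \<le> emeasure \<zeta>' F"
\<comment> \<open>Since \<open>infdist x {}\<close> is \<open>0\<close> by convention, the
  neighbourhoods of an empty \<open>F\<close> would be the whole space.\<close>
proof (cases "F = {}")
  case False
  let ?F = "\<lambda>\<delta>::real. {x. infdist x F \<le> \<delta>}"
  have closed: "closed (?F \<delta>)" for \<delta>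
    by (intro closed_Collect_le continuous_intros)
  have sets: "sets (\<Gamma> k) = sets borel" and fst: "\<zeta> = distr (\<Gamma> k) borel fst"
    and snd: "\<zeta>' = distr (\<Gamma> k) borel snd" and prob: "prob_space (\<Gamma> k)" for k
    using C[of k] by (auto simp: couplings_def space_prob_algebra borel_prod)
  have meas [measurable_cong]: "sets (\<Gamma> k) = sets (borel \<Otimes>\<^sub>M borel)" for k
    unfolding sets borel_prod ..
  have near: "emeasure \<zeta> F \<le> emeasure \<zeta>' (?F \<delta>)" if \<delta>: "0 < \<delta>" "\<delta> \<le> 1" for \<delta>
  proof (rule LIMSEQ_le_const)
    have "(\<lambda>k. emeasure \<zeta>' (?F \<delta>) + ennreal (1 / \<delta>) *
        (\<integral>\<^sup>+p. ennreal (min 1 (dist (fst p) (snd p))) \<partial>\<Gamma> k))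
      \<longlonglongrightarrow> emeasure \<zeta>' (?F \<delta>) + ennreal (1 / \<delta>) * 0"
      using lim by (intro tendsto_add tendsto_const ennreal_tendsto_cmult) auto
    then show "(\<lambda>k. emeasure \<zeta>' (?F \<delta>) + ennreal (1 / \<delta>) *
        (\<integral>\<^sup>+p. ennreal (min 1 (dist (fst p) (snd p))) \<partial>\<Gamma> k)) \<longlonglongrightarrow> emeasure \<zeta>' (?F \<delta>)"
      by simp
    have "emeasure \<zeta> F \<le> emeasure \<zeta>' (?F \<delta>) + ennreal (1 / \<delta>) *
        (\<integral>\<^sup>+p. ennreal (min 1 (dist (fst p) (snd p))) \<partial>\<Gamma> k)" for k
    proof -
      have [measurable]: "F \<in> sets borel" "?F \<delta> \<in> sets borel"
        using F closed by (auto intro: borel_closed)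
      have "emeasure \<zeta> F = (\<integral>\<^sup>+p. indicator F (fst p) \<partial>\<Gamma> k)"
        unfolding fst[of k] by (subst nn_integral_indicator[symmetric], simp, subst nn_integral_distr) auto
      also have "\<dots> \<le> (\<integral>\<^sup>+p. indicator (?F \<delta>) (snd p) +
          ennreal (1 / \<delta>) * ennreal (min 1 (dist (fst p) (snd p))) \<partial>\<Gamma> k)"
      proof (rule nn_integral_mono)
        fix p :: "'a \<times> 'a"
        consider "fst p \<notin> F" | "snd p \<in> ?F \<delta>" | "fst p \<in> F" "snd p \<notin> ?F \<delta>" by blast
        then show "indicator F (fst p) \<le> indicator (?F \<delta>) (snd p) +
          ennreal (1 / \<delta>) * ennreal (min 1 (dist (fst p) (snd p)))"
        proof cases
          case 3
          then have "\<delta> \<le> dist (fst p) (snd p)"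
            using infdist_le[of "fst p" F "snd p"] by (auto simp: dist_commute)
          \<comment> \<open>Truncating the distance at 1 does no harm to Markov's inequality because
            \<open>\<delta> \<le> 1\<close>.\<close>
          then have "1 \<le> 1 / \<delta> * min 1 (dist (fst p) (snd p))"
            using \<delta> by (simp add: field_simps)
          then have "1 \<le> ennreal (1 / \<delta>) * ennreal (min 1 (dist (fst p) (snd p)))"
            using \<delta> by (simp add: ennreal_mult[symmetric] flip: ennreal_1)
          then show ?thesis using 3 by simp
        qed (auto simp: indicator_def add_increasing2)
      qed
      also have "\<dots> = (\<integral>\<^sup>+p. indicator (?F \<delta>) (snd p) \<partial>\<Gamma> k) +
          ennreal (1 / \<delta>) * (\<integral>\<^sup>+p. ennreal (min 1 (dist (fst p) (snd p))) \<partial>\<Gamma> k)"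
        by (simp add: nn_integral_add nn_integral_cmult)
      also have "(\<integral>\<^sup>+p. indicator (?F \<delta>) (snd p) \<partial>\<Gamma> k) = emeasure \<zeta>' (?F \<delta>)"
        unfolding snd[of k] by (subst nn_integral_indicator[symmetric], simp, subst nn_integral_distr) auto
      finally show ?thesis .
    qed
    then show "\<exists>N. \<forall>k\<ge>N. emeasure \<zeta> F \<le> emeasure \<zeta>' (?F \<delta>) + ennreal (1 / \<delta>) *
        (\<integral>\<^sup>+p. ennreal (min 1 (dist (fst p) (snd p))) \<partial>\<Gamma> k)" by blast
  qed
  interpret \<zeta>': prob_space \<zeta>'
    unfolding snd[of 0] by (rule prob_space.prob_space_distr[OF prob]) simp
  have "sets \<zeta>' = sets borel" unfolding snd[of 0] by simp
  \<comment> \<open>Continuity from above along the radii 1/(n+1), all of which are at most 1 as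
    \<open>near\<close> demands.\<close>
  then have "(\<lambda>n. emeasure \<zeta>' (?F (1 / real (Suc n)))) \<longlonglongrightarrow>
    emeasure \<zeta>' (\<Inter>n. ?F (1 / real (Suc n)))"
    using closed
    by (intro Lim_emeasure_decseq)
      (auto simp: decseq_def simp del: of_nat_Suc intro!: borel_closed divide_left_mono elim!: order_trans)
  also have "(\<Inter>n. ?F (1 / real (Suc n))) = F"
  proof (intro set_eqI iffI)
    fix x assume x: "x \<in> (\<Inter>n. ?F (1 / real (Suc n)))"
    have "infdist x F \<le> 0"
      by (rule LIMSEQ_le_const[OF LIMSEQ_inverse_real_of_nat]) (use x in \<open>auto simp: inverse_eq_divide\<close>)
    then show "x \<in> F"
      using in_closed_iff_infdist_zero[OF F False] infdist_nonneg[of x F] by simp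
  qed (use False in \<open>auto simp: infdist_zero\<close>)
  finally show ?thesis
    by (rule LIMSEQ_le_const) (auto intro!: near)
qed simp

text \<open>The contraction holds on average over the noise; a single map
  \<open>\<lambda>x. T x z\<close> may expand distances or be discontinuous.\<close>

locale contractive_random_map = random_map P T
  for P :: "'z measure" and T :: "'a::{banach, second_countable_topology} \<Rightarrow> 'z \<Rightarrow> 'a" +
  fixes s :: real
  assumes s: "0 \<le> s" "s < 1"
    and contraction: "\<And>x y. (\<integral>\<^sup>+z. ennreal (dist (T x z) (T y z)) \<partial>P) \<le> ennreal (s * dist x y)"
begin

text \<open>The coupled chain is started from the product of the two laws. Invariance keeps both
  marginals fixed while the truncated cost tends to zero.\<close>

lemma emeasure_closed_le_if_invariant:
  assumes inv: "invariant_distribution (map_kernel P T) \<pi>" "invariant_distribution (map_kernel P T) \<pi>'"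
    and F: "closed F"
  shows "emeasure \<pi> F \<le> emeasure \<pi>' F"
proof -
  interpret pair: random_map P "pair_map T" by (rule random_map_pair)
  let ?K = "map_kernel P (pair_map T)"
  let ?d = "\<lambda>p::'a \<times> 'a. dist (fst p) (snd p)"
  define \<Gamma> where "\<Gamma> = \<pi> \<Otimes>\<^sub>M \<pi>'"
  have \<pi>: "sets \<pi> = sets borel" "prob_space \<pi>" "sets \<pi>' = sets borel" "prob_space \<pi>'"
    using inv by (auto simp: invariant_distribution_def space_prob_algebra)
  interpret \<pi>: prob_space \<pi> by fact
  interpret \<pi>': prob_space \<pi>' by fact
  interpret pair_prob_space \<pi> \<pi>' ..
  have space: "space \<pi> = UNIV" "space \<pi>' = UNIV"
    using \<pi> by (auto dest: sets_eq_imp_space_eq)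
  have iter: "iterate_kernel (map_kernel P T) k \<pi> = \<pi>" "iterate_kernel (map_kernel P T) k \<pi>' = \<pi>'" for k
    using inv by (induction k) (auto simp: invariant_distribution_def)
  have sets_\<Gamma>: "sets \<Gamma> = sets (borel \<Otimes>\<^sub>M borel)"
    unfolding \<Gamma>_def using \<pi> by (intro sets_pair_measure_cong)
  have "distr \<Gamma> borel fst = \<pi>"
    using \<pi>'.distr_pair_fst[of \<pi>] distr_cong[of \<Gamma> \<Gamma> borel \<pi> fst fst] \<pi> by (simp add: \<Gamma>_def)
  moreover have "distr \<Gamma> borel snd = \<pi>'"
  proof (rule measure_eqI)
    fix A assume "A \<in> sets (distr \<Gamma> borel snd)"
    then have A: "A \<in> sets borel" by simp
    have "snd -` A \<inter> space \<Gamma> = UNIV \<times> A"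
      using space by (auto simp: \<Gamma>_def space_pair_measure)
    then have "emeasure (distr \<Gamma> borel snd) A = emeasure \<Gamma> (UNIV \<times> A)"
      using A sets_\<Gamma> by (subst emeasure_distr) (auto cong: measurable_cong_sets)
    also have "\<dots> = emeasure \<pi>' A"
      using A \<pi> \<pi>.emeasure_space_1 space \<pi>'.emeasure_pair_measure_Times[of UNIV \<pi> A] by (simp add: \<Gamma>_def)
    finally show "emeasure (distr \<Gamma> borel snd) A = emeasure \<pi>' A" .
  qed (simp add: \<pi>)
  ultimately have \<Gamma>: "\<Gamma> \<in> couplings \<pi> \<pi>'"
    using sets_\<Gamma> prob_space_axioms by (simp add: couplings_def space_prob_algebra \<Gamma>_def)
  have \<Gamma>_alg: "\<Gamma> \<in> space (prob_algebra borel)"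
    using \<Gamma> by (simp add: couplings_def borel_prod)
  have ret: "return borel p \<in> space (prob_algebra borel)" for p :: "'a \<times> 'a"
    by (simp add: space_prob_algebra prob_space_return)
  have d_meas [measurable]: "?d \<in> borel_measurable borel"
    by measurable
  have step: "(\<integral>\<^sup>+q. ennreal (?d q) \<partial>?K p) \<le> ennreal s * ennreal (?d p) + 0" for p
    using contraction[of "fst p" "snd p"] s
    by (subst pair.nn_integral_map_kernel) (auto simp: ennreal_mult)
  have decay: "(\<integral>\<^sup>+q. ennreal (?d q) \<partial>iterate_kernel ?K k (return borel p)) \<le> ennreal (s ^ k * ?d p)"
    for k p
    using nn_integral_iterate_kernel_drift[OF pair.map_kernel_measurable ret[of p] _ step, where B = 0 and k = k] s
    by (simp add: nn_integral_return ennreal_mult ennreal_power)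
  \<comment> \<open>The distance need not be integrable under \<open>\<Gamma>\<close>, so
    \<open>decay\<close> cannot be integrated directly. Truncation gives the dominating function 1,
    and \<open>decay\<close> is used only for each fixed \<open>p\<close>.\<close>
  let ?e = "\<lambda>k p. \<integral>\<^sup>+q. ennreal (min 1 (?d q)) \<partial>iterate_kernel ?K k (return borel p)"
  have e_meas: "?e k \<in> borel_measurable \<Gamma>" for k
  proof -
    have "?e k \<in> borel_measurable borel"
      using measurable_prob_algebraD[OF measurable_iterate_kernel[OF pair.map_kernel_measurable]]
      by (rule measurable_compose[OF _ nn_integral_measurable_subprob_algebra]) measurable
    then show ?thesis
      using measurable_cong_sets[OF sets_\<Gamma> refl] unfolding borel_prod by blast
  qed
  have "(\<lambda>k. \<integral>\<^sup>+p. ?e k p \<partial>\<Gamma>) \<longlonglongrightarrow> (\<integral>\<^sup>+p. 0 \<partial>\<Gamma>)"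
  proof (rule nn_integral_dominated_convergence)
    show "AE p in \<Gamma>. ?e k p \<le> 1" for k
    proof (rule AE_I2)
      fix p
      interpret iter: prob_space "iterate_kernel ?K k (return borel p)"
        using iterate_kernel_prob_algebra[OF pair.map_kernel_measurable ret] by (simp add: space_prob_algebra)
      have "?e k p \<le> (\<integral>\<^sup>+q. 1 \<partial>iterate_kernel ?K k (return borel p))"
        by (intro nn_integral_mono) (simp flip: ennreal_1)
      then show "?e k p \<le> 1" by (simp add: iter.emeasure_space_1)
    qed
    show "AE p in \<Gamma>. (\<lambda>k. ?e k p) \<longlonglongrightarrow> 0"
    proof (rule AE_I2)
      fix p
      have "(\<lambda>k. ennreal (s ^ k * ?d p)) \<longlonglongrightarrow> ennreal (0 * ?d p)"
        using s by (intro tendsto_intros LIMSEQ_power_zero) simp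
      then have lim: "(\<lambda>k. ennreal (s ^ k * ?d p)) \<longlonglongrightarrow> 0" by simp
      have "?e k p \<le> ennreal (s ^ k * ?d p)" for k
        using decay[of k p] by (rule order_trans[rotated]) (intro nn_integral_mono ennreal_leI, simp)
      then show "(\<lambda>k. ?e k p) \<longlonglongrightarrow> 0"
        by (intro tendsto_sandwich[OF _ _ tendsto_const lim] always_eventually allI zero_le)
    qed
    show "(\<integral>\<^sup>+p. 1 \<partial>\<Gamma>) < \<infinity>"
      using emeasure_space_1 by (simp add: \<Gamma>_def)
  qed (rule e_meas, rule borel_measurable_const, rule borel_measurable_const)
  then have lim: "(\<lambda>k. \<integral>\<^sup>+p. ennreal (min 1 (?d p)) \<partial>iterate_kernel ?K k \<Gamma>) \<longlonglongrightarrow> 0"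
    by (simp add: nn_integral_iterate_kernel[OF pair.map_kernel_measurable \<Gamma>_alg])
  have "iterate_kernel ?K k \<Gamma> \<in> couplings \<pi> \<pi>'" for k
    using couplings_iterate[OF \<Gamma>, of k] by (simp add: iter)
  then show ?thesis
    by (rule emeasure_closed_le_if_couplings[OF _ lim F])
qed

text \<open>The preceding inequality also holds with the two laws exchanged, so they agree on the
  closed sets, an intersection-stable generator of the Borel sets.\<close>

lemma invariant_distribution_unique:
  assumes inv: "invariant_distribution (map_kernel P T) \<pi>" "invariant_distribution (map_kernel P T) \<pi>'"
  shows "\<pi> = \<pi>'"
proof (rule measure_eqI_generator_eq[where E = "Collect closed" and \<Omega> = UNIV and A = "\<lambda>_. UNIV"])
  show "emeasure \<pi> F = emeasure \<pi>' F" if "F \<in> Collect closed" for F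
    using that by (intro antisym emeasure_closed_le_if_invariant inv) auto
  have "sets (borel :: 'a measure) = sigma_sets UNIV (Collect closed)"
    by (subst borel_eq_closed) (simp add: sets_measure_of)
  then show "sets \<pi> = sigma_sets UNIV (Collect closed)" "sets \<pi>' = sigma_sets UNIV (Collect closed)"
    using inv by (auto simp: invariant_distribution_def space_prob_algebra)
  show "emeasure \<pi> UNIV \<noteq> \<infinity>"
    using inv(1) by (auto simp: invariant_distribution_def dest: in_space_prob_algebra)
qed (auto simp: Int_stable_def)

end

subsection \<open>Existence of an invariant distribution by backward iteration\<close>

text \<open>Telescoping with the triangle inequality; in \<open>ennreal\<close> an infinite path
  length just makes the bound trivial.\<close>

lemma dist_lim_le_suminf:
  fixes u :: "nat \<Rightarrow> 'a::metric_space"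
  assumes "u \<longlonglongrightarrow> l"
  shows "ennreal (dist (u 0) l) \<le> (\<Sum>j. ennreal (dist (u (Suc j)) (u j)))"
proof (rule LIMSEQ_le_const2)
  show "(\<lambda>n. ennreal (dist (u 0) (u n))) \<longlonglongrightarrow> ennreal (dist (u 0) l)"
    by (intro tendsto_intros assms)
  have "dist (u 0) (u n) \<le> (\<Sum>j<n. dist (u (Suc j)) (u j))" for n
  proof (induction n)
    case (Suc n)
    have "dist (u 0) (u (Suc n)) \<le> dist (u 0) (u n) + dist (u (Suc n)) (u n)"
      by (metis dist_commute dist_triangle)
    then show ?case using Suc by simp
  qed simp
  then have "ennreal (dist (u 0) (u n)) \<le> (\<Sum>j<n. ennreal (dist (u (Suc j)) (u j)))" for n
    by (simp add: sum_ennreal ennreal_leI)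
  then have "ennreal (dist (u 0) (u n)) \<le> (\<Sum>j. ennreal (dist (u (Suc j)) (u j)))" for n
    by (rule order_trans) (intro sum_le_suminf, auto)
  then show "\<exists>N. \<forall>n\<ge>N. ennreal (dist (u 0) (u n)) \<le> (\<Sum>j. ennreal (dist (u (Suc j)) (u j)))"
    by blast
qed

text \<open>A finite path length makes the series of increments absolutely convergent, hence
  convergent by completeness, and its partial sums telescope.\<close>

lemma convergent_if_dist_summable:
  fixes u :: "nat \<Rightarrow> 'a::banach"
  assumes "(\<Sum>j. ennreal (dist (u (Suc j)) (u j))) < \<infinity>"
  shows "convergent u"
proof -
  have "summable (\<lambda>j. norm (u (Suc j) - u j))"
    using assms by (intro summable_suminf_not_top) (auto simp: dist_norm top.not_eq_extremum)
  then have "convergent (\<lambda>n. \<Sum>j<n. u (Suc j) - u j)"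
    by (simp add: summable_norm_cancel summable_iff_convergent[symmetric])
  then show ?thesis
    by (simp add: sum_lessThan_telescope convergent_diff_const_right_iff)
qed

lemma eq_0_if_le_geometric:
  fixes a :: ennreal
  assumes s: "0 \<le> s" "s < 1" and D: "D < \<infinity>" and le: "\<And>k. a \<le> ennreal (s ^ k) * D"
  shows "a = 0"
proof -
  have "(\<lambda>k. ennreal (s ^ k * enn2real D)) \<longlonglongrightarrow> ennreal (0 * enn2real D)"
    using s by (intro tendsto_intros LIMSEQ_power_zero) simp
  moreover have "a \<le> ennreal (s ^ k * enn2real D)" for k
    using le[of k] D s by (simp add: ennreal_mult)
  ultimately have "a \<le> ennreal (0 * enn2real D)"
    by (intro LIMSEQ_le_const) auto
  then show ?thesis by simp
qed

text \<open>The newest noise is applied first and \<open>shd \<omega>\<close> last: unlike the forward iterates, these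
converge almost surely.\<close>
primrec backward :: "('a \<Rightarrow> 'z \<Rightarrow> 'a) \<Rightarrow> 'a \<Rightarrow> nat \<Rightarrow> 'z stream \<Rightarrow> 'a" where
  "backward T x 0 \<omega> = x"
| "backward T x (Suc k) \<omega> = T (backward T x k (stl \<omega>)) (shd \<omega>)"

context random_map
begin

lemma measurable_T_compose [measurable (raw)]:
  "f \<in> borel_measurable N \<Longrightarrow> g \<in> N \<rightarrow>\<^sub>M P \<Longrightarrow> (\<lambda>x. T (f x) (g x)) \<in> borel_measurable N"
  using measurable_compose[OF measurable_Pair T_measurable, of f N g] by simp

lemma measurable_backward [measurable]: "backward T x k \<in> borel_measurable (stream_space P)"
proof (induction k)
  case (Suc k)
  note [measurable] = Suc
  have "(\<lambda>\<omega>. T (backward T x k (stl \<omega>)) (shd \<omega>)) \<in> borel_measurable (stream_space P)"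
    by measurable
  then show ?case by simp
qed (simp add: backward.simps(1)[abs_def])

end

context contractive_random_map
begin

text \<open>The two iterates share all noises but the innermost one. Each outer map contributes a
  factor \<open>s\<close> in expectation, and the innermost one contributes the displacement of
  \<open>x\<close> under a single step.\<close>

lemma backward_step:
  "(\<integral>\<^sup>+\<omega>. ennreal (dist (backward T x (Suc k) \<omega>) (backward T x k \<omega>)) \<partial>stream_space P)
    \<le> ennreal (s ^ k) * (\<integral>\<^sup>+z. ennreal (dist (T x z) x) \<partial>P)"
proof (induction k)
  case 0
  have "(\<integral>\<^sup>+\<omega>. ennreal (dist (backward T x (Suc 0) \<omega>) (backward T x 0 \<omega>)) \<partial>stream_space P)
    = (\<integral>\<^sup>+z. ennreal (dist (T x z) x) \<partial>P)"
    using prob_space.emeasure_space_1[OF prob_space_stream_space]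
    by (subst nn_integral_stream_space) simp_all
  then show ?case by simp
next
  case (Suc k)
  interpret S: prob_space "stream_space P" by (rule prob_space_stream_space)
  interpret pair_sigma_finite P "stream_space P" ..
  let ?X = "backward T x"
  have "(\<integral>\<^sup>+\<omega>. ennreal (dist (?X (Suc (Suc k)) \<omega>) (?X (Suc k) \<omega>)) \<partial>stream_space P)
    = (\<integral>\<^sup>+z. \<integral>\<^sup>+\<omega>. ennreal (dist (T (?X (Suc k) \<omega>) z) (T (?X k \<omega>) z)) \<partial>stream_space P \<partial>P)"
    by (subst nn_integral_stream_space) simp_all
  \<comment> \<open>The head of the stream is independent of its tail, so it can be integrated first
    with both arguments of \<open>T\<close> frozen.\<close>
  also have "\<dots> = (\<integral>\<^sup>+\<omega>. \<integral>\<^sup>+z. ennreal (dist (T (?X (Suc k) \<omega>) z) (T (?X k \<omega>) z)) \<partial>P \<partial>stream_space P)"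
    by (rule Fubini'[symmetric]) measurable
  also have "\<dots> \<le> (\<integral>\<^sup>+\<omega>. ennreal s * ennreal (dist (?X (Suc k) \<omega>) (?X k \<omega>)) \<partial>stream_space P)"
    using contraction s by (intro nn_integral_mono) (simp add: ennreal_mult)
  also have "\<dots> = ennreal s * (\<integral>\<^sup>+\<omega>. ennreal (dist (?X (Suc k) \<omega>) (?X k \<omega>)) \<partial>stream_space P)"
    by (intro nn_integral_cmult) measurable
  also have "\<dots> \<le> ennreal s * (ennreal (s ^ k) * (\<integral>\<^sup>+z. ennreal (dist (T x z) x) \<partial>P))"
    by (intro mult_left_mono Suc) simp
  also have "\<dots> = ennreal (s ^ Suc k) * (\<integral>\<^sup>+z. ennreal (dist (T x z) x) \<partial>P)"
    using s by (simp add: ennreal_mult mult.assoc)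
  finally show ?case .
qed

text \<open>The limit \<open>Y\<close> of the backward iterates satisfies
  \<open>Y (z ## \<omega>) = T (Y \<omega>) z\<close> almost surely. As \<open>z\<close> is
  independent of \<open>\<omega>\<close> and prepending it reproduces the law of the stream, the law
  of \<open>Y\<close> is invariant.\<close>

lemma invariant_distribution_exists:
  assumes fin: "(\<integral>\<^sup>+z. ennreal (dist (T x z) x) \<partial>P) < \<infinity>"
  shows "\<exists>\<pi>. invariant_distribution (map_kernel P T) \<pi>"
proof -
  interpret S: prob_space "stream_space P" by (rule prob_space_stream_space)
  interpret pair_sigma_finite P "stream_space P" ..
  let ?X = "backward T x"
  \<comment> \<open>Where the iterates diverge, \<open>lim\<close> takes an unspecified value;
    \<open>conv\<close> below shows that this happens only on a null set.\<close>
  define Y where "Y \<omega> = lim (\<lambda>k. ?X k \<omega>)" for \<omega>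
  have Y [measurable]: "Y \<in> borel_measurable (stream_space P)"
    unfolding Y_def[abs_def] by measurable
  let ?D = "\<lambda>k \<omega>. ennreal (dist (?X (Suc k) \<omega>) (?X k \<omega>))"
  \<comment> \<open>\<open>D\<close> bounds the expected total path length of the backward
    iterates.\<close>
  define D where "D = (\<Sum>j. ennreal (s ^ j)) * (\<integral>\<^sup>+z. ennreal (dist (T x z) x) \<partial>P)"
  have "(\<Sum>j. ennreal (s ^ j)) = ennreal (\<Sum>j. s ^ j)"
    using s by (intro suminf_ennreal2 summable_geometric) auto
  then have D: "D < \<infinity>"
    using fin by (simp add: D_def ennreal_mult_less_top)
  have tail: "(\<integral>\<^sup>+\<omega>. (\<Sum>j. ?D (k + j) \<omega>) \<partial>stream_space P) \<le> ennreal (s ^ k) * D" for k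
  proof -
    have "(\<integral>\<^sup>+\<omega>. (\<Sum>j. ?D (k + j) \<omega>) \<partial>stream_space P)
      = (\<Sum>j. \<integral>\<^sup>+\<omega>. ?D (k + j) \<omega> \<partial>stream_space P)"
      by (intro nn_integral_suminf) measurable
    also have "\<dots> \<le> (\<Sum>j. ennreal (s ^ (k + j)) * (\<integral>\<^sup>+z. ennreal (dist (T x z) x) \<partial>P))"
      by (intro suminf_le backward_step) auto
    also have "\<dots> = (\<Sum>j. ennreal (s ^ k) * (ennreal (s ^ j) * (\<integral>\<^sup>+z. ennreal (dist (T x z) x) \<partial>P)))"
      using s by (simp add: power_add ennreal_mult mult.assoc)
    also have "\<dots> = ennreal (s ^ k) * D"
      by (simp add: D_def)
    finally show ?thesis .
  qed
  have "(\<integral>\<^sup>+\<omega>. (\<Sum>j. ?D j \<omega>) \<partial>stream_space P) < \<infinity>"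
    using tail[of 0] D by (simp add: order.strict_trans1)
  then have "AE \<omega> in stream_space P. (\<Sum>j. ?D j \<omega>) \<noteq> \<infinity>"
    by (intro nn_integral_PInf_AE) auto
  then have conv: "AE \<omega> in stream_space P. (\<lambda>k. ?X k \<omega>) \<longlonglongrightarrow> Y \<omega>"
    unfolding Y_def
    by eventually_elim (auto simp: convergent_LIMSEQ_iff[symmetric] top.not_eq_extremum
        intro!: convergent_if_dist_summable)
  have near: "(\<integral>\<^sup>+\<omega>. ennreal (dist (?X k \<omega>) (Y \<omega>)) \<partial>stream_space P) \<le> ennreal (s ^ k) * D" for k
  proof -
    have "AE \<omega> in stream_space P. ennreal (dist (?X k \<omega>) (Y \<omega>)) \<le> (\<Sum>j. ?D (k + j) \<omega>)"
      using conv
    proof eventually_elim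
      case (elim \<omega>)
      then have "(\<lambda>j. ?X (k + j) \<omega>) \<longlonglongrightarrow> Y \<omega>"
        by (subst add.commute) (rule LIMSEQ_ignore_initial_segment)
      from dist_lim_le_suminf[OF this] show ?case by simp
    qed
    then show ?thesis
      by (rule order_trans[OF nn_integral_mono_AE tail])
  qed
  have "(\<integral>\<^sup>+z. \<integral>\<^sup>+\<omega>. ennreal (dist (T (Y \<omega>) z) (Y (z ## \<omega>))) \<partial>stream_space P \<partial>P) = 0"
  proof (rule eq_0_if_le_geometric[OF s])
    show "2 * D < \<infinity>"
      using D by (simp add: ennreal_mult_less_top)
    fix k
    have "(\<integral>\<^sup>+z. \<integral>\<^sup>+\<omega>. ennreal (dist (T (Y \<omega>) z) (Y (z ## \<omega>))) \<partial>stream_space P \<partial>P)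
      \<le> (\<integral>\<^sup>+z. \<integral>\<^sup>+\<omega>. ennreal (dist (T (?X k \<omega>) z) (T (Y \<omega>) z))
          + ennreal (dist (?X (Suc k) (z ## \<omega>)) (Y (z ## \<omega>))) \<partial>stream_space P \<partial>P)"
    proof (intro nn_integral_mono)
      fix z \<omega>
      have "dist (T (Y \<omega>) z) (Y (z ## \<omega>))
        \<le> dist (T (?X k \<omega>) z) (T (Y \<omega>) z) + dist (?X (Suc k) (z ## \<omega>)) (Y (z ## \<omega>))"
        by (simp add: dist_triangle3)
      then show "ennreal (dist (T (Y \<omega>) z) (Y (z ## \<omega>)))
        \<le> ennreal (dist (T (?X k \<omega>) z) (T (Y \<omega>) z)) + ennreal (dist (?X (Suc k) (z ## \<omega>)) (Y (z ## \<omega>)))"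
        by (simp add: ennreal_leI flip: ennreal_plus)
    qed
    also have "\<dots> = (\<integral>\<^sup>+z. (\<integral>\<^sup>+\<omega>. ennreal (dist (T (?X k \<omega>) z) (T (Y \<omega>) z)) \<partial>stream_space P)
      + (\<integral>\<^sup>+\<omega>. ennreal (dist (?X (Suc k) (z ## \<omega>)) (Y (z ## \<omega>))) \<partial>stream_space P) \<partial>P)"
      by (intro nn_integral_cong nn_integral_add) measurable
    also have "\<dots> = (\<integral>\<^sup>+z. \<integral>\<^sup>+\<omega>. ennreal (dist (T (?X k \<omega>) z) (T (Y \<omega>) z)) \<partial>stream_space P \<partial>P)
      + (\<integral>\<^sup>+z. \<integral>\<^sup>+\<omega>. ennreal (dist (?X (Suc k) (z ## \<omega>)) (Y (z ## \<omega>))) \<partial>stream_space P \<partial>P)"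
      by (intro nn_integral_add) measurable
    also have "(\<integral>\<^sup>+z. \<integral>\<^sup>+\<omega>. ennreal (dist (?X (Suc k) (z ## \<omega>)) (Y (z ## \<omega>))) \<partial>stream_space P \<partial>P)
      = (\<integral>\<^sup>+\<omega>. ennreal (dist (?X (Suc k) \<omega>) (Y \<omega>)) \<partial>stream_space P)"
      by (subst (2) nn_integral_stream_space) (simp_all del: backward.simps)
    also have "\<dots> \<le> ennreal (s ^ Suc k) * D" by (rule near)
    also have "\<dots> \<le> ennreal (s ^ k) * D"
      using s by (intro mult_right_mono ennreal_leI) (auto simp: mult_left_le_one_le)
    also have "(\<integral>\<^sup>+z. \<integral>\<^sup>+\<omega>. ennreal (dist (T (?X k \<omega>) z) (T (Y \<omega>) z)) \<partial>stream_space P \<partial>P)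
      = (\<integral>\<^sup>+\<omega>. \<integral>\<^sup>+z. ennreal (dist (T (?X k \<omega>) z) (T (Y \<omega>) z)) \<partial>P \<partial>stream_space P)"
      by (rule Fubini'[symmetric]) measurable
    also have "\<dots> \<le> (\<integral>\<^sup>+\<omega>. ennreal (dist (?X k \<omega>) (Y \<omega>)) \<partial>stream_space P)"
    proof (intro nn_integral_mono order_trans[OF contraction] ennreal_leI)
      show "s * dist (?X k \<omega>) (Y \<omega>) \<le> dist (?X k \<omega>) (Y \<omega>)" for \<omega>
        using s by (intro mult_left_le_one_le) auto
    qed
    also have "\<dots> \<le> ennreal (s ^ k) * D" by (rule near)
    finally show "(\<integral>\<^sup>+z. \<integral>\<^sup>+\<omega>. ennreal (dist (T (Y \<omega>) z) (Y (z ## \<omega>))) \<partial>stream_space P \<partial>P)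
      \<le> ennreal (s ^ k) * (2 * D)"
      by (simp add: mult_2 distrib_left add_mono add_right_mono add_left_mono)
  qed
  then have "AE z in P. (\<integral>\<^sup>+\<omega>. ennreal (dist (T (Y \<omega>) z) (Y (z ## \<omega>))) \<partial>stream_space P) = 0"
    by (subst (asm) nn_integral_0_iff_AE) auto
  then have fixed: "AE z in P. AE \<omega> in stream_space P. Y (z ## \<omega>) = T (Y \<omega>) z"
    using AE_space
  proof eventually_elim
    case (elim z)
    then have [measurable]: "z \<in> space P" by simp
    have "AE \<omega> in stream_space P. ennreal (dist (T (Y \<omega>) z) (Y (z ## \<omega>))) = 0"
      using elim by (subst (asm) nn_integral_0_iff_AE) auto
    then show ?case by eventually_elim auto
  qed
  define \<pi> where "\<pi> = distr (stream_space P) borel Y"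
  have \<pi>: "\<pi> \<in> space (prob_algebra borel)"
    using S.prob_space_distr[OF Y] by (simp add: \<pi>_def space_prob_algebra)
  have "\<pi> \<bind> map_kernel P T = \<pi>"
  proof (rule measure_eqI)
    show sets: "sets (\<pi> \<bind> map_kernel P T) = sets \<pi>"
      using sets_bind'[OF \<pi> map_kernel_measurable] by (simp add: \<pi>_def)
    fix A assume "A \<in> sets (\<pi> \<bind> map_kernel P T)"
    then have A [measurable]: "A \<in> sets borel"
      using sets by (simp add: \<pi>_def)
    have "emeasure \<pi> A = (\<integral>\<^sup>+\<omega>. indicator A (Y \<omega>) \<partial>stream_space P)"
      unfolding \<pi>_def by (subst nn_integral_indicator[symmetric], simp, subst nn_integral_distr) auto
    also have "\<dots> = (\<integral>\<^sup>+z. \<integral>\<^sup>+\<omega>. indicator A (Y (z ## \<omega>)) \<partial>stream_space P \<partial>P)"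
      by (subst nn_integral_stream_space) simp_all
    also have "\<dots> = (\<integral>\<^sup>+z. \<integral>\<^sup>+\<omega>. indicator A (T (Y \<omega>) z) \<partial>stream_space P \<partial>P)"
    proof (rule nn_integral_cong_AE)
      show "AE z in P. (\<integral>\<^sup>+\<omega>. indicator A (Y (z ## \<omega>)) \<partial>stream_space P) =
        (\<integral>\<^sup>+\<omega>. indicator A (T (Y \<omega>) z) \<partial>stream_space P)"
        using fixed
      proof eventually_elim
        case (elim z)
        then show ?case
          by (intro nn_integral_cong_AE) (auto elim: eventually_mono)
      qed
    qed
    also have "\<dots> = (\<integral>\<^sup>+\<omega>. \<integral>\<^sup>+z. indicator A (T (Y \<omega>) z) \<partial>P \<partial>stream_space P)"
      by (rule Fubini'[symmetric]) measurable
    also have "\<dots> = (\<integral>\<^sup>+\<omega>. \<integral>\<^sup>+y. indicator A y \<partial>map_kernel P T (Y \<omega>) \<partial>stream_space P)"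
      by (simp add: nn_integral_map_kernel)
    also have "\<dots> = (\<integral>\<^sup>+x. \<integral>\<^sup>+y. indicator A y \<partial>map_kernel P T x \<partial>\<pi>)"
    proof -
      have "(\<lambda>x. \<integral>\<^sup>+y. indicator A y \<partial>map_kernel P T x) \<in> borel_measurable borel"
        using measurable_prob_algebraD[OF map_kernel_measurable]
        by (rule measurable_compose[OF _ nn_integral_measurable_subprob_algebra]) measurable
      then show ?thesis
        unfolding \<pi>_def by (subst nn_integral_distr) auto
    qed
    also have "\<dots> = (\<integral>\<^sup>+y. indicator A y \<partial>(\<pi> \<bind> map_kernel P T))"
      using nn_integral_bind_kernel[OF map_kernel_measurable \<pi>, of "indicator A"] by simp
    also have "\<dots> = emeasure (\<pi> \<bind> map_kernel P T) A"
      using A sets by (simp add: \<pi>_def)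
    finally show "emeasure (\<pi> \<bind> map_kernel P T) A = emeasure \<pi> A" ..
  qed
  with \<pi> show ?thesis
    unfolding invariant_distribution_def by blast
qed

end

subsection \<open>Contraction in mean square\<close>

text \<open>Cauchy--Schwarz with real bounds on the second moments. The product integral is finite
  because its square has a finite bound, so the root can be taken in the reals.\<close>

lemma nn_integral_mult_le_sqrt:
  assumes [measurable]: "f \<in> borel_measurable M" "g \<in> borel_measurable M"
    and nonneg: "\<And>x. 0 \<le> f x" "\<And>x. 0 \<le> g x" "0 \<le> A" "0 \<le> B"
    and f: "(\<integral>\<^sup>+x. ennreal ((f x)\<^sup>2) \<partial>M) \<le> ennreal A"
    and g: "(\<integral>\<^sup>+x. ennreal ((g x)\<^sup>2) \<partial>M) \<le> ennreal B"
  shows "(\<integral>\<^sup>+x. ennreal (f x * g x) \<partial>M) \<le> ennreal (sqrt A * sqrt B)"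
proof -
  let ?I = "\<integral>\<^sup>+x. ennreal (f x * g x) \<partial>M"
  have "?I\<^sup>2 \<le> (\<integral>\<^sup>+x. ennreal ((f x)\<^sup>2) \<partial>M) * (\<integral>\<^sup>+x. ennreal ((g x)\<^sup>2) \<partial>M)"
    using Cauchy_Schwarz_nn_integral[of "\<lambda>x. ennreal (f x)" M "\<lambda>x. ennreal (g x)"] nonneg
    by (simp add: ennreal_mult ennreal_power)
  also have "\<dots> \<le> ennreal A * ennreal B"
    by (intro mult_mono f g) auto
  also have "\<dots> = ennreal ((sqrt A * sqrt B)\<^sup>2)"
    using nonneg by (simp add: ennreal_mult power_mult_distrib)
  finally have le: "?I\<^sup>2 \<le> ennreal ((sqrt A * sqrt B)\<^sup>2)" .
  show ?thesis
  proof (cases ?I)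
    case (real i)
    then have "i\<^sup>2 \<le> (sqrt A * sqrt B)\<^sup>2"
      using le by (simp add: ennreal_power)
    then have "i \<le> sqrt A * sqrt B"
      by (rule power2_le_imp_le) (use nonneg in simp)
    then show ?thesis using real by (simp add: ennreal_leI)
  next
    case top
    then show ?thesis using le by (simp add: top_unique)
  qed
qed

text \<open>The additive term has the form \<open>(1 - r) * B\<close> so that \<open>B\<close> is
  the fixed point of the drift recursion, hence the asymptotic bound on the second moment around
  \<open>a\<close>.\<close>

locale mean_square_contraction = random_map P T
  for P :: "'z measure" and T :: "'a::euclidean_space \<Rightarrow> 'z \<Rightarrow> 'a" +
  fixes r B :: real and a :: 'a
  assumes r: "0 \<le> r" "r < 1" and B: "0 \<le> B"
    and contraction2: "\<And>x y. (\<integral>\<^sup>+z. ennreal ((norm (T x z - T y z))\<^sup>2) \<partial>P) \<le> ennreal (r * (norm (x - y))\<^sup>2)"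
    and drift2: "\<And>x. (\<integral>\<^sup>+z. ennreal ((norm (T x z - a))\<^sup>2) \<partial>P)
      \<le> ennreal (r * (norm (x - a))\<^sup>2 + (1 - r) * B)"
begin

lemma nn_integral_le_sqrt:
  assumes [measurable]: "f \<in> borel_measurable P"
    and "\<And>z. 0 \<le> f z" "0 \<le> A" "(\<integral>\<^sup>+z. ennreal ((f z)\<^sup>2) \<partial>P) \<le> ennreal A"
  shows "(\<integral>\<^sup>+z. ennreal (f z) \<partial>P) \<le> ennreal (sqrt A)"
  using nn_integral_mult_le_sqrt[of f P "\<lambda>_. 1" A 1] assms by (simp add: emeasure_space_1)

text \<open>Cauchy--Schwarz against the constant 1 turns the mean-square factor \<open>r\<close>
  into the factor \<open>sqrt r\<close> for the mean distance.\<close>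

sublocale contractive_random_map P T "sqrt r"
proof
  show "0 \<le> sqrt r" "sqrt r < 1" using r by auto
  fix x y
  show "(\<integral>\<^sup>+z. ennreal (dist (T x z) (T y z)) \<partial>P) \<le> ennreal (sqrt r * dist x y)"
    using nn_integral_le_sqrt[of "\<lambda>z. dist (T x z) (T y z)", OF _ _ _ contraction2[of x y, folded dist_norm]] r
    by (simp add: real_sqrt_mult)
qed

text \<open>Backward iteration is started at \<open>a\<close>, where \<open>drift2\<close> makes the
  expected first displacement finite.\<close>

lemma ex1_invariant_distribution: "\<exists>!\<pi>. invariant_distribution (map_kernel P T) \<pi>"
proof -
  have "(\<integral>\<^sup>+z. ennreal (dist (T a z) a) \<partial>P) \<le> ennreal (sqrt (r * (norm (a - a))\<^sup>2 + (1 - r) * B))"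
    using drift2[of a] r B
    by (intro nn_integral_le_sqrt) (auto simp: dist_norm)
  also have "\<dots> < \<infinity>" by simp
  finally show ?thesis
    using invariant_distribution_exists invariant_distribution_unique by blast
qed

text \<open>The cost is a sum of three products with the distance as a factor. Cauchy--Schwarz on
  each takes the decay \<open>sqrt r ^ k\<close> from the distance, while the other factor merely
  stays bounded.\<close>

lemma nn_integral_iterate_cost:
  defines "K \<equiv> map_kernel P (pair_map T)"
  defines "c \<equiv> \<lambda>p :: 'a \<times> 'a. norm (fst p - snd p) * (norm (fst p - a) + norm (snd p - a) + 2 * sqrt B)"
  shows "(\<integral>\<^sup>+q. ennreal (c q) \<partial>iterate_kernel K k (return borel p)) \<le> ennreal (2 * sqrt r ^ k * c p)"
proof -
  interpret pair: random_map P "pair_map T" by (rule random_map_pair)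
  note K = pair.map_kernel_measurable[folded K_def]
  have ret: "return borel p \<in> space (prob_algebra borel)"
    by (simp add: space_prob_algebra prob_space_return)
  let ?\<rho> = "iterate_kernel K k (return borel p)"
  note \<rho> = iterate_kernel_prob_algebra[OF K ret, of k]
  interpret \<rho>: prob_space ?\<rho>
    using \<rho> by (simp add: space_prob_algebra)
  note [measurable_cong] = sets_prob_algebra[OF \<rho>]
  let ?d = "\<lambda>p::'a \<times> 'a. norm (fst p - snd p)"
  let ?w = "sqrt r ^ k * ?d p"
  have rk: "r ^ k \<le> 1" and rk0: "0 \<le> r ^ k" using r by (auto intro: power_le_one)
  have d2: "(\<integral>\<^sup>+q. ennreal ((?d q)\<^sup>2) \<partial>?\<rho>) \<le> ennreal (r ^ k * (?d p)\<^sup>2)"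
  proof -
    have "(\<integral>\<^sup>+q. ennreal ((?d q)\<^sup>2) \<partial>K q') \<le> ennreal r * ennreal ((?d q')\<^sup>2) + 0" for q'
      using contraction2[of "fst q'" "snd q'"] r
      unfolding K_def by (subst pair.nn_integral_map_kernel) (auto simp: ennreal_mult)
    from nn_integral_iterate_kernel_drift[OF K ret _ this, where B = 0 and k = k] r show ?thesis
      by (simp add: nn_integral_return ennreal_mult ennreal_power)
  qed
  have V2: "(\<integral>\<^sup>+q. ennreal ((norm (\<pi> q - a))\<^sup>2) \<partial>?\<rho>) \<le> ennreal (r ^ k * (norm (\<pi> p - a))\<^sup>2 + B)"
    if [measurable]: "\<pi> \<in> borel_measurable borel" and \<pi>: "\<And>q z. \<pi> (pair_map T q z) = T (\<pi> q) z" for \<pi>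
  proof -
    have step: "(\<integral>\<^sup>+q. ennreal ((norm (\<pi> q - a))\<^sup>2) \<partial>K q')
      \<le> ennreal r * ennreal ((norm (\<pi> q' - a))\<^sup>2) + ennreal ((1 - r) * B)" for q'
      using drift2[of "\<pi> q'"] r B \<pi>
      unfolding K_def by (subst pair.nn_integral_map_kernel) (auto simp: ennreal_mult)
    have "ennreal r * ennreal B + ennreal ((1 - r) * B) = ennreal (r * B + (1 - r) * B)"
      using r B by (simp add: ennreal_mult)
    also have "r * B + (1 - r) * B = B" by (simp add: algebra_simps)
    finally have "ennreal r * ennreal B + ennreal ((1 - r) * B) \<le> ennreal B" by simp
    from nn_integral_iterate_kernel_drift[OF K ret _ step this, where k = k] r B show ?thesis
      by (simp add: nn_integral_return ennreal_mult ennreal_power)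
  qed
  have cross: "(\<integral>\<^sup>+q. ennreal (?d q * norm (\<pi> q - a)) \<partial>?\<rho>) \<le> ennreal (?w * (norm (\<pi> p - a) + sqrt B))"
    if [measurable]: "\<pi> \<in> borel_measurable borel" and \<pi>: "\<And>q z. \<pi> (pair_map T q z) = T (\<pi> q) z" for \<pi>
  proof -
    have "(\<integral>\<^sup>+q. ennreal (?d q * norm (\<pi> q - a)) \<partial>?\<rho>)
      \<le> ennreal (sqrt (r ^ k * (?d p)\<^sup>2) * sqrt (r ^ k * (norm (\<pi> p - a))\<^sup>2 + B))"
      by (rule nn_integral_mult_le_sqrt[OF _ _ _ _ _ _ d2 V2[OF that]]) (use r B in auto)
    also have "sqrt (r ^ k * (?d p)\<^sup>2) = ?w"
      by (simp add: real_sqrt_mult real_sqrt_power)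
    also have "sqrt (r ^ k * (norm (\<pi> p - a))\<^sup>2 + B) \<le> sqrt (r ^ k * (norm (\<pi> p - a))\<^sup>2) + sqrt B"
      using rk0 B by (intro sqrt_add_le_add_sqrt) auto
    \<comment> \<open>The decay of this factor is given up: the constant \<open>B\<close> beside it
      does not decay.\<close>
    also have "sqrt (r ^ k * (norm (\<pi> p - a))\<^sup>2) \<le> norm (\<pi> p - a)"
      using rk rk0 by (auto simp: real_sqrt_mult intro!: mult_left_le_one_le)
    finally show ?thesis
      using r by (simp add: ennreal_leI mult_left_mono)
  qed
  have d1: "(\<integral>\<^sup>+q. ennreal (?d q * (2 * sqrt B)) \<partial>?\<rho>) \<le> ennreal (?w * (2 * sqrt B))"
  proof -
    have "(\<integral>\<^sup>+q. ennreal ((2 * sqrt B)\<^sup>2) \<partial>?\<rho>) \<le> ennreal ((2 * sqrt B)\<^sup>2)"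
      by (simp add: \<rho>.emeasure_space_1)
    from nn_integral_mult_le_sqrt[OF _ _ _ _ _ _ d2 this] show ?thesis
      using r B by (simp add: real_sqrt_mult real_sqrt_power power_mult_distrib mult_ac)
  qed
  have "(\<integral>\<^sup>+q. ennreal (c q) \<partial>?\<rho>) = (\<integral>\<^sup>+q. ennreal (?d q * norm (fst q - a)) \<partial>?\<rho>) +
      (\<integral>\<^sup>+q. ennreal (?d q * norm (snd q - a)) \<partial>?\<rho>) + (\<integral>\<^sup>+q. ennreal (?d q * (2 * sqrt B)) \<partial>?\<rho>)"
    using B by (simp add: c_def distrib_left nn_integral_add)
  also have "\<dots> \<le> ennreal (?w * (norm (fst p - a) + sqrt B)) + ennreal (?w * (norm (snd p - a) + sqrt B))
      + ennreal (?w * (2 * sqrt B))"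
    by (intro add_mono cross d1) auto
  also have "\<dots> = ennreal (?w * (norm (fst p - a) + norm (snd p - a) + 4 * sqrt B))"
    using r B by (simp add: algebra_simps flip: ennreal_plus)
  also have "\<dots> \<le> ennreal (2 * sqrt r ^ k * c p)"
  proof (rule ennreal_leI)
    \<comment> \<open>Each cross term has added one \<open>sqrt B\<close> to the constant
      \<open>2 * sqrt B\<close> of the cost; the resulting \<open>4 * sqrt B\<close> is what costs
      the factor 2.\<close>
    have "?w * (norm (fst p - a) + norm (snd p - a) + 4 * sqrt B)
      \<le> ?w * (2 * (norm (fst p - a) + norm (snd p - a) + 2 * sqrt B))"
      using r B by (intro mult_left_mono) auto
    then show "?w * (norm (fst p - a) + norm (snd p - a) + 4 * sqrt B) \<le> 2 * sqrt r ^ k * c p"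
      by (simp add: c_def algebra_simps)
  qed
  finally show ?thesis .
qed

lemma wasserstein_iterate_le:
  defines "c \<equiv> \<lambda>x y. norm (x - y) * (norm (x - a) + norm (y - a) + 2 * sqrt B)"
  assumes C: "2 * sqrt r ^ k \<le> C" "0 < C"
  shows "wasserstein c (iterate_kernel (map_kernel P T) k \<zeta>) (iterate_kernel (map_kernel P T) k \<zeta>')
    \<le> ennreal C * wasserstein c \<zeta> \<zeta>'"
proof -
  interpret pair: random_map P "pair_map T" by (rule random_map_pair)
  let ?K = "map_kernel P (pair_map T)"
  let ?W = "wasserstein c (iterate_kernel (map_kernel P T) k \<zeta>) (iterate_kernel (map_kernel P T) k \<zeta>')"
  let ?c = "\<lambda>p. c (fst p) (snd p)"
  have c [measurable]: "?c \<in> borel_measurable borel"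
    unfolding c_def by measurable
  have c0: "0 \<le> ?c p" for p
    using B by (simp add: c_def)
  \<comment> \<open>Dividing by \<open>C\<close> puts the infimum alone on the right, so the bound
    can be proved against each coupling separately.\<close>
  have "?W / ennreal C \<le> wasserstein c \<zeta> \<zeta>'"
    unfolding wasserstein_def[of c \<zeta> \<zeta>']
  proof (intro INF_greatest divide_le_posI_ennreal)
    show "0 < ennreal C" using C by simp
    fix \<Gamma> assume \<Gamma>: "\<Gamma> \<in> couplings \<zeta> \<zeta>'"
    then have \<Gamma>': "\<Gamma> \<in> space (prob_algebra borel)"
      by (simp add: couplings_def borel_prod)
    note [measurable_cong] = sets_prob_algebra[OF \<Gamma>']
    have "?W \<le> (\<integral>\<^sup>+p. ennreal (?c p) \<partial>iterate_kernel ?K k \<Gamma>)"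
      unfolding wasserstein_def by (intro INF_lower couplings_iterate \<Gamma>)
    also have "\<dots> = (\<integral>\<^sup>+p. \<integral>\<^sup>+q. ennreal (?c q) \<partial>iterate_kernel ?K k (return borel p) \<partial>\<Gamma>)"
      by (intro nn_integral_iterate_kernel pair.map_kernel_measurable \<Gamma>') measurable
    also have "\<dots> \<le> (\<integral>\<^sup>+p. ennreal C * ennreal (?c p) \<partial>\<Gamma>)"
    proof (rule nn_integral_mono)
      fix p
      have "(\<integral>\<^sup>+q. ennreal (?c q) \<partial>iterate_kernel ?K k (return borel p)) \<le> ennreal (2 * sqrt r ^ k * ?c p)"
        using nn_integral_iterate_cost[of k p] by (simp add: c_def)
      also have "\<dots> \<le> ennreal C * ennreal (?c p)"
        using C c0[of p] by (simp add: ennreal_leI mult_right_mono flip: ennreal_mult)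
      finally show "(\<integral>\<^sup>+q. ennreal (?c q) \<partial>iterate_kernel ?K k (return borel p)) \<le> ennreal C * ennreal (?c p)" .
    qed
    also have "\<dots> = ennreal C * (\<integral>\<^sup>+p. ennreal (?c p) \<partial>\<Gamma>)"
      by (intro nn_integral_cmult) measurable
    finally show "?W \<le> ennreal C * (\<integral>\<^sup>+p. ennreal (?c p) \<partial>\<Gamma>)" .
  qed
  then have "ennreal C * (?W / ennreal C) \<le> ennreal C * wasserstein c \<zeta> \<zeta>'"
    by (rule mult_left_mono) simp
  moreover have "ennreal C * (?W / ennreal C) = ?W"
    using C by (simp add: ennreal_times_divide mult.commute[of "ennreal C"] ennreal_mult_divide_eq)
  ultimately show ?thesis by simp
qed

end

subsection \<open>Stochastic gradient descent\<close>

text \<open>Along each coordinate line through \<open>x\<close> the restriction of \<open>f\<close>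
  has a minimum at parameter 0, where its derivative vanishes.\<close>

lemma grad_eq_0_at_minimizer:
  fixes f :: "real^'d::finite \<Rightarrow> real"
  assumes diff: "f differentiable (at x)" and min: "\<And>y. f x \<le> f y"
  shows "grad f x = 0"
proof -
  have "partial_deriv i f x = 0" for i
  proof -
    let ?g = "\<lambda>t::real. f (x + t *\<^sub>R axis i 1)"
    have "(f \<circ> (\<lambda>t::real. x + t *\<^sub>R axis i 1)) differentiable (at 0)"
      using diff by (intro differentiable_chain_at) auto
    then have "(?g has_real_derivative deriv ?g 0) (at 0)"
      by (simp add: comp_def DERIV_deriv_iff_real_differentiable)
    then show ?thesis
      unfolding partial_deriv_def by (rule DERIV_local_min[of _ _ _ 1]) (auto intro: min)
  qed
  then show ?thesis
    by (simp add: grad_def vec_eq_iff)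
qed

text \<open>Sum of the strong convexity inequality and the one with \<open>x\<close> and
  \<open>y\<close> exchanged.\<close>

lemma strongly_convex_monotone:
  assumes "strongly_convex \<mu> f"
  shows "\<mu> * (norm (x - y))\<^sup>2 \<le> (grad f x - grad f y) \<bullet> (x - y)"
proof -
  have "\<mu> / 2 * (norm (x - y))\<^sup>2 \<le> f x - f y - grad f y \<bullet> (x - y)"
    and "\<mu> / 2 * (norm (y - x))\<^sup>2 \<le> f y - f x - grad f x \<bullet> (y - x)"
    using assms by (auto simp: strongly_convex_def)
  then show ?thesis
    by (simp add: norm_minus_commute inner_diff_left inner_diff_right)
qed

text \<open>Serves both the contraction, with \<open>h\<close> a difference of two stochastic
  gradients, and the drift, with \<open>h\<close> a single one.\<close>

lemma (in prob_space) expectation_norm_diff_square: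
  fixes h :: "'a \<Rightarrow> 'b::euclidean_space"
  assumes h: "integrable M h" "integrable M (\<lambda>z. (norm (h z))\<^sup>2)"
  shows "(\<integral>\<^sup>+z. ennreal ((norm (v - \<gamma> *\<^sub>R h z))\<^sup>2) \<partial>M) =
    ennreal ((norm v)\<^sup>2 - 2 * \<gamma> * (expectation h \<bullet> v) + \<gamma>\<^sup>2 * expectation (\<lambda>z. (norm (h z))\<^sup>2))"
proof -
  have eq: "(norm (v - \<gamma> *\<^sub>R h z))\<^sup>2 = (norm v)\<^sup>2 - 2 * \<gamma> * (h z \<bullet> v) + \<gamma>\<^sup>2 * (norm (h z))\<^sup>2" for z
    by (simp add: power2_norm_eq_inner inner_diff_left inner_diff_right inner_commute)
      (simp add: power2_eq_square algebra_simps)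
  have nonneg: "0 \<le> (norm v)\<^sup>2 - 2 * \<gamma> * (h z \<bullet> v) + \<gamma>\<^sup>2 * (norm (h z))\<^sup>2" for z
    by (simp flip: eq)
  show ?thesis
    unfolding eq by (subst nn_integral_eq_integral) (use h nonneg in \<open>auto simp: prob_space\<close>)
qed

theorem proposition1:
  fixes f :: "real^'d::finite \<Rightarrow> real"
    and G :: "real^'d \<Rightarrow> 'z \<Rightarrow> real^'d"
    and P :: "'z measure"
    and M :: "'w measure"
    and \<xi> :: "nat \<Rightarrow> 'w \<Rightarrow> 'z"
    and \<theta>0 :: "'w \<Rightarrow> real^'d"
    and \<theta>s :: "real^'d"
    and \<mu> L1 L2 L3 L4 L \<tau>2 \<gamma> :: real
  assumes prob_P: "prob_space P"
    and meas_G: "(\<lambda>(\<theta>, z). G \<theta> z) \<in> borel_measurable (borel \<Otimes>\<^sub>M P)"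
    and minimizer: "\<And>\<theta>. \<theta> \<noteq> \<theta>s \<Longrightarrow> f \<theta>s < f \<theta>"
    and A1: "\<mu> > 0" "Ck 1 f" "strongly_convex \<mu> f"
    and A2: "Ck 4 f"
      "\<And>\<theta> \<theta>'. norm (grad f \<theta> - grad f \<theta>') \<le> L2 * norm (\<theta> - \<theta>')"
      "\<And>\<theta>. tensor_norm 3 (\<lambda>js. partial_derivs js f \<theta>) \<le> L3"
      "\<And>\<theta>. tensor_norm 4 (\<lambda>js. partial_derivs js f \<theta>) \<le> L4"
    and A3_noise: "prob_space M"
      "prob_space.indep_vars M (\<lambda>_. P) \<xi> {1..}"
      "\<And>k. k \<ge> 1 \<Longrightarrow> distr M P (\<xi> k) = P"
      "indep_rvs M borel \<theta>0 (PiM {1..} (\<lambda>_. P)) (\<lambda>\<omega>. \<lambda>k\<in>{1..}. \<xi> k \<omega>)"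
    and A3_unbiased: "\<And>\<theta>. integrable P (G \<theta>)"
      "\<And>\<theta>. (\<integral>z. G \<theta> z \<partial>P) = grad f \<theta>"
    and A3_moment: "integrable P (\<lambda>z. (norm (G \<theta>s z))\<^sup>2)"
      "sqrt (\<integral>z. (norm (G \<theta>s z))\<^sup>2 \<partial>P) \<le> \<tau>2"
    and A3_cocoercive: "L1 > 0"
      "\<And>\<theta>1 \<theta>2. integrable P (\<lambda>z. (norm (G \<theta>1 z - G \<theta>2 z))\<^sup>2)"
      "\<And>\<theta>1 \<theta>2. L1 * ((grad f \<theta>1 - grad f \<theta>2) \<bullet> (\<theta>1 - \<theta>2))
          \<ge> (\<integral>z. (norm (G \<theta>1 z - G \<theta>2 z))\<^sup>2 \<partial>P)"
    and L: "L = Max {L1, L2, L3, L4}"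
    and \<gamma>: "\<gamma> \<in> {0 <.. 1 / (2 * L)}"
  shows "(\<exists>!\<pi>. invariant_distribution (sgd_kernel P G \<gamma>) \<pi>) \<and>
    (\<forall>\<pi>. invariant_distribution (sgd_kernel P G \<gamma>) \<pi> \<longrightarrow>
      (\<forall>\<nu> \<in> space (prob_algebra borel). \<forall>k::nat.
        wasserstein (sgd_cost \<theta>s \<tau>2 \<mu> \<gamma>) (iterate_kernel (sgd_kernel P G \<gamma>) k \<nu>) \<pi>
        \<le> ennreal (4 * (1 / 2) powr (real k / real_of_int \<lceil>2 * ln 4 / (\<gamma> * \<mu>)\<rceil>)) *
          wasserstein (sgd_cost \<theta>s \<tau>2 \<mu> \<gamma>) \<nu> \<pi>))"
proof -
  interpret P: prob_space P by (fact prob_P)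
  define T where "T x z = x - \<gamma> *\<^sub>R G x z" for x z
  define r where "r = 1 - \<gamma> * \<mu>"
  define B where "B = 2 * \<gamma> * \<tau>2\<^sup>2 / \<mu>"
  have L1: "L1 \<le> L" using L by simp
  have \<gamma>0: "0 < \<gamma>" using \<gamma> by simp
  have \<gamma>L: "\<gamma> * L \<le> 1 / 2"
    using \<gamma> L1 A3_cocoercive(1) by (simp add: field_simps)
  then have \<gamma>L1: "\<gamma> * L1 \<le> 1 / 2"
    using mult_left_mono[OF L1 less_imp_le[OF \<gamma>0]] by linarith
  have \<tau>2: "0 \<le> \<tau>2" and moment: "(\<integral>z. (norm (G \<theta>s z))\<^sup>2 \<partial>P) \<le> \<tau>2\<^sup>2"
  proof -
    show "0 \<le> \<tau>2"
      using A3_moment(2) by (rule order_trans[rotated]) simp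
    show "(\<integral>z. (norm (G \<theta>s z))\<^sup>2 \<partial>P) \<le> \<tau>2\<^sup>2"
      using A3_moment(2) by (rule sqrt_le_D)
  qed
  have grad0: "grad f \<theta>s = 0"
  proof (rule grad_eq_0_at_minimizer)
    show "f differentiable (at \<theta>s)" using A1(2) by simp
    show "f \<theta>s \<le> f y" for y
      using minimizer[of y] by (cases "y = \<theta>s") auto
  qed
  have T_meas: "case_prod T \<in> borel_measurable (borel \<Otimes>\<^sub>M P)"
    using meas_G unfolding T_def[abs_def] split_beta' by measurable
  have G_meas [measurable]: "G x \<in> borel_measurable P" for x
    using A3_unbiased(1) by (rule borel_measurable_integrable)
  have contraction: "(\<integral>\<^sup>+z. ennreal ((norm (T x z - T y z))\<^sup>2) \<partial>P) \<le> ennreal (r * (norm (x - y))\<^sup>2)" for x y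
  proof -
    let ?m = "(grad f x - grad f y) \<bullet> (x - y)"
    let ?e = "\<integral>z. (norm (G x z - G y z))\<^sup>2 \<partial>P"
    have "(\<integral>\<^sup>+z. ennreal ((norm (T x z - T y z))\<^sup>2) \<partial>P) =
      (\<integral>\<^sup>+z. ennreal ((norm ((x - y) - \<gamma> *\<^sub>R (G x z - G y z)))\<^sup>2) \<partial>P)"
      by (simp add: T_def algebra_simps)
    also have "\<dots> = ennreal ((norm (x - y))\<^sup>2 - 2 * \<gamma> * ?m + \<gamma>\<^sup>2 * ?e)"
      using A3_unbiased A3_cocoercive(2) by (subst P.expectation_norm_diff_square) auto
    also have "\<dots> \<le> ennreal (r * (norm (x - y))\<^sup>2)"
    proof (rule ennreal_leI)
      have m: "\<mu> * (norm (x - y))\<^sup>2 \<le> ?m"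
        by (rule strongly_convex_monotone[OF A1(3)])
      then have m0: "0 \<le> ?m"
        using A1(1) by (meson mult_nonneg_nonneg less_imp_le order_trans zero_le_power2)
      \<comment> \<open>Co-coercivity lets half of the gain \<open>2 * \<gamma> * ?m\<close> absorb
        the quadratic term; the other half yields the contraction by strong convexity.\<close>
      have "\<gamma>\<^sup>2 * ?e \<le> \<gamma>\<^sup>2 * (L1 * ?m)"
        using A3_cocoercive(3) by (intro mult_left_mono) auto
      also have "\<dots> = \<gamma> * (\<gamma> * L1) * ?m" by (simp add: power2_eq_square)
      also have "\<dots> \<le> \<gamma> * 1 * ?m"
        using \<gamma>0 \<gamma>L1 m0 by (intro mult_right_mono mult_left_mono) auto
      finally have "(norm (x - y))\<^sup>2 - 2 * \<gamma> * ?m + \<gamma>\<^sup>2 * ?e \<le> (norm (x - y))\<^sup>2 - \<gamma> * ?m"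
        by simp
      also have "\<dots> \<le> (norm (x - y))\<^sup>2 - \<gamma> * (\<mu> * (norm (x - y))\<^sup>2)"
        using m \<gamma>0 by simp
      also have "\<dots> = r * (norm (x - y))\<^sup>2" by (simp add: r_def algebra_simps)
      finally show "(norm (x - y))\<^sup>2 - 2 * \<gamma> * ?m + \<gamma>\<^sup>2 * ?e \<le> r * (norm (x - y))\<^sup>2" .
    qed
    finally show ?thesis .
  qed
  have drift: "(\<integral>\<^sup>+z. ennreal ((norm (T x z - \<theta>s))\<^sup>2) \<partial>P)
    \<le> ennreal (r * (norm (x - \<theta>s))\<^sup>2 + (1 - r) * B)" for x
  proof -
    let ?m = "grad f x \<bullet> (x - \<theta>s)"
    let ?e = "\<integral>z. (norm (G x z))\<^sup>2 \<partial>P"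
    \<comment> \<open>Splits off the noise at the minimizer, whose second moment is controlled by
      \<open>\<tau>2\<close>. The factor 2 in front of the difference is why the absorption below
      uses the full strength of \<open>\<gamma> * L1 \<le> 1 / 2\<close>.\<close>
    have le: "(norm (G x z))\<^sup>2 \<le> 2 * (norm (G x z - G \<theta>s z))\<^sup>2 + 2 * (norm (G \<theta>s z))\<^sup>2" for z
    proof -
      have "0 \<le> (norm (G x z - 2 *\<^sub>R G \<theta>s z))\<^sup>2" by simp
      then show ?thesis
        by (simp add: power2_norm_eq_inner inner_diff_left inner_diff_right inner_commute)
    qed
    have int: "integrable P (\<lambda>z. 2 * (norm (G x z - G \<theta>s z))\<^sup>2 + 2 * (norm (G \<theta>s z))\<^sup>2)"
      using A3_cocoercive(2) A3_moment(1) by simp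
    have int_G: "integrable P (\<lambda>z. (norm (G x z))\<^sup>2)"
      using le by (intro Bochner_Integration.integrable_bound[OF int]) auto
    have "?e \<le> (\<integral>z. 2 * (norm (G x z - G \<theta>s z))\<^sup>2 + 2 * (norm (G \<theta>s z))\<^sup>2 \<partial>P)"
      by (intro integral_mono int int_G le)
    also have "\<dots> = 2 * (\<integral>z. (norm (G x z - G \<theta>s z))\<^sup>2 \<partial>P) + 2 * (\<integral>z. (norm (G \<theta>s z))\<^sup>2 \<partial>P)"
      using A3_cocoercive(2) A3_moment(1) by simp
    also have "\<dots> \<le> 2 * (L1 * ?m) + 2 * \<tau>2\<^sup>2"
      using A3_cocoercive(3)[where ?\<theta>1.0 = x and ?\<theta>2.0 = \<theta>s] moment grad0 by simp
    finally have e: "?e \<le> 2 * (L1 * ?m) + 2 * \<tau>2\<^sup>2" .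
    have "(\<integral>\<^sup>+z. ennreal ((norm (T x z - \<theta>s))\<^sup>2) \<partial>P) =
      (\<integral>\<^sup>+z. ennreal ((norm ((x - \<theta>s) - \<gamma> *\<^sub>R G x z))\<^sup>2) \<partial>P)"
      by (simp add: T_def algebra_simps)
    also have "\<dots> = ennreal ((norm (x - \<theta>s))\<^sup>2 - 2 * \<gamma> * ?m + \<gamma>\<^sup>2 * ?e)"
      using A3_unbiased int_G by (subst P.expectation_norm_diff_square) auto
    also have "\<dots> \<le> ennreal (r * (norm (x - \<theta>s))\<^sup>2 + (1 - r) * B)"
    proof (rule ennreal_leI)
      have m: "\<mu> * (norm (x - \<theta>s))\<^sup>2 \<le> ?m"
        using strongly_convex_monotone[OF A1(3), of x \<theta>s] grad0 by simp
      then have m0: "0 \<le> ?m"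
        using A1(1) by (meson mult_nonneg_nonneg less_imp_le order_trans zero_le_power2)
      have "\<gamma>\<^sup>2 * ?e \<le> \<gamma>\<^sup>2 * (2 * (L1 * ?m) + 2 * \<tau>2\<^sup>2)"
        using e by (intro mult_left_mono) auto
      also have "\<dots> = 2 * \<gamma> * (\<gamma> * L1) * ?m + 2 * \<gamma>\<^sup>2 * \<tau>2\<^sup>2"
        by (simp add: power2_eq_square algebra_simps)
      also have "\<dots> \<le> 2 * \<gamma> * (1 / 2) * ?m + 2 * \<gamma>\<^sup>2 * \<tau>2\<^sup>2"
        using \<gamma>0 \<gamma>L1 m0 by (intro add_right_mono mult_right_mono mult_left_mono) auto
      finally have "(norm (x - \<theta>s))\<^sup>2 - 2 * \<gamma> * ?m + \<gamma>\<^sup>2 * ?e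
          \<le> (norm (x - \<theta>s))\<^sup>2 - \<gamma> * ?m + 2 * \<gamma>\<^sup>2 * \<tau>2\<^sup>2"
        by simp
      also have "\<dots> \<le> (norm (x - \<theta>s))\<^sup>2 - \<gamma> * (\<mu> * (norm (x - \<theta>s))\<^sup>2) + 2 * \<gamma>\<^sup>2 * \<tau>2\<^sup>2"
        using m \<gamma>0 by simp
      \<comment> \<open>\<open>B\<close> was chosen so that \<open>(1 - r) * B\<close> equals the
        noise term \<open>2 * \<gamma>\<^sup>2 * \<tau>2\<^sup>2\<close>.\<close>
      also have "\<dots> = r * (norm (x - \<theta>s))\<^sup>2 + (1 - r) * B"
        using A1(1) by (simp add: r_def B_def algebra_simps power2_eq_square)
      finally show "(norm (x - \<theta>s))\<^sup>2 - 2 * \<gamma> * ?m + \<gamma>\<^sup>2 * ?e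
          \<le> r * (norm (x - \<theta>s))\<^sup>2 + (1 - r) * B" .
    qed
    finally show ?thesis .
  qed
  have r: "0 \<le> r" "r < 1"
  proof -
    \<comment> \<open>Any unit vector would do. Comparing strong monotonicity with the Lipschitz
      bound along it gives \<mu> \<le> L2, hence \<gamma> \<mu> \<le> 1/2.\<close>
    define v :: "real^'d" where "v = axis undefined 1"
    have v: "norm v = 1" by (simp add: v_def)
    have "\<mu> \<le> (grad f v - grad f 0) \<bullet> v"
      using strongly_convex_monotone[OF A1(3), of v 0] v by simp
    also have "\<dots> \<le> norm (grad f v - grad f 0) * norm v"
      by (rule norm_cauchy_schwarz)
    also have "\<dots> \<le> L2"
      using A2(2)[of v 0] v by simp
    also have "\<dots> \<le> L" using L by simp
    finally have "\<gamma> * \<mu> \<le> \<gamma> * L"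
      using \<gamma>0 by (intro mult_left_mono) auto
    also have "\<dots> \<le> 1 / 2" by (rule \<gamma>L)
    finally show "0 \<le> r" by (simp add: r_def)
    show "r < 1" using \<gamma>0 A1(1) by (simp add: r_def)
  qed
  interpret mean_square_contraction P T r B \<theta>s
    using T_meas r contraction drift \<gamma>0 A1(1) by unfold_locales (auto simp: B_def)
  have kernel: "sgd_kernel P G \<gamma> = map_kernel P T"
    by (intro ext) (simp add: sgd_kernel_def map_kernel_def T_def[abs_def])
  \<comment> \<open>Nonnegativity of \<open>\<tau>2\<close> enters here: it makes the square root of
    \<open>\<tau>2\<^sup>2\<close> equal to \<open>\<tau>2\<close>.\<close>
  have cost: "sgd_cost \<theta>s \<tau>2 \<mu> \<gamma> =
    (\<lambda>x y. norm (x - y) * (norm (x - \<theta>s) + norm (y - \<theta>s) + 2 * sqrt B))"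
    using \<tau>2 by (intro ext) (simp add: sgd_cost_def B_def real_sqrt_mult real_sqrt_divide)
  \<comment> \<open>With m the ceiling, \<open>r \<le> exp (- (\<gamma> * \<mu>))\<close> and m
    \<ge> 4 ln 2 / (\<gamma> \<mu>) reduce the comparison to ln 2 / m \<le> \<gamma> \<mu> / 2,
    which holds with room to spare.\<close>
  have rate: "2 * sqrt r ^ k \<le> 4 * (1 / 2) powr (real k / real_of_int \<lceil>2 * ln 4 / (\<gamma> * \<mu>)\<rceil>)" for k
  proof -
    let ?m = "real_of_int \<lceil>2 * ln 4 / (\<gamma> * \<mu>)\<rceil>"
    have \<gamma>\<mu>: "0 < \<gamma> * \<mu>" using \<gamma>0 A1(1) by simp
    have "ln (4::real) = 2 * ln 2"
      using ln_realpow[of 2 2] by simp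
    then have "4 * ln 2 / (\<gamma> * \<mu>) \<le> ?m"
      using le_of_int_ceiling[of "2 * ln 4 / (\<gamma> * \<mu>)"] by simp
    moreover have m0: "0 < ?m"
      using \<gamma>\<mu> by simp
    ultimately have "ln 2 / ?m \<le> \<gamma> * \<mu> / 4"
      using \<gamma>\<mu> by (simp add: field_simps)
    also have "\<dots> \<le> \<gamma> * \<mu> / 2" using \<gamma>\<mu> by simp
    finally have "real k * (ln 2 / ?m) \<le> real k * (\<gamma> * \<mu> / 2)"
      by (rule mult_left_mono) simp
    then have le: "exp (real k * - (\<gamma> * \<mu> / 2)) \<le> (1 / 2) powr (real k / ?m)"
      by (simp add: powr_def ln_div)
    have "sqrt r \<le> sqrt (exp (- (\<gamma> * \<mu>)))"
      using exp_ge_add_one_self[of "- (\<gamma> * \<mu>)"] by (simp add: r_def)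
    also have "\<dots> = exp (- (\<gamma> * \<mu> / 2))"
      by (intro real_sqrt_unique) (simp_all add: power2_eq_square flip: exp_add)
    finally have "sqrt r ^ k \<le> exp (- (\<gamma> * \<mu> / 2)) ^ k"
      using r by (intro power_mono) auto
    also have "\<dots> = exp (real k * - (\<gamma> * \<mu> / 2))"
      by (simp only: exp_of_nat_mult)
    also note le
    finally have "sqrt r ^ k \<le> (1 / 2) powr (real k / ?m)" .
    moreover have "0 \<le> (1 / 2) powr (real k / ?m)" by simp
    ultimately show ?thesis by linarith
  qed
  have "wasserstein (sgd_cost \<theta>s \<tau>2 \<mu> \<gamma>) (iterate_kernel (sgd_kernel P G \<gamma>) k \<nu>) \<pi>
      \<le> ennreal (4 * (1 / 2) powr (real k / real_of_int \<lceil>2 * ln 4 / (\<gamma> * \<mu>)\<rceil>)) *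
        wasserstein (sgd_cost \<theta>s \<tau>2 \<mu> \<gamma>) \<nu> \<pi>"
    if inv: "invariant_distribution (sgd_kernel P G \<gamma>) \<pi>" for \<pi> \<nu> k
  proof -
    \<comment> \<open>Invariance lets \<open>\<pi>\<close> be read as its own k-step law, so that
      the bound for two moving laws applies.\<close>
    have "iterate_kernel (map_kernel P T) k \<pi> = \<pi>"
      using inv by (induction k) (auto simp: kernel invariant_distribution_def)
    then show ?thesis
      using wasserstein_iterate_le[OF rate[of k], of \<nu> \<pi>] by (simp add: kernel cost)
  qed
  then show ?thesis
    using ex1_invariant_distribution by (auto simp: kernel)
qed

end
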